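(* Let $f(\zeta,t)$, $0\le t<\infty$, be a global in time locally univalent solution of the Polubarinova-Galin equation $$\operatorname{Re}\left[\dot f(\zeta,t)\overline{\zeta f'(\zeta,t)}\right]=q(t)\qquad(\zeta\in\partial\mathbb{D}),$$ so that for every $t\geq 0$, $f(\cdot,t)$ is analytic in a neighborhood of $\overline{\mathbb{D}}$ with $f(0,t)=0$, $f'(0,t)>0$ and $f'\ne0$ on $\overline{\mathbb{D}}$, driven by injection with rate $q(t)>0$ such that $Q(t)=\int_0^tq(s)\,ds\to\infty$ as $t\to\infty$. Then $f(\cdot,t)$ is univalent (one-to-one) on $\overline{\mathbb{D}}$ for all $0\le t<\infty$.
   Context: $\mathbb{D}$ is the open unit disk; dot denotes $\partial/\partial t$ and prime denotes $\partial/\partial\zeta$. The function $q$ is continuous and given in advance. A locally univalent solution is a smooth map $t\mapsto f(\cdot,t)$, with values in the set of functions analytic in a neighborhood of $\overline{\mathbb{D}}$ with $f(0)=0$, $f'(0)>0$ and $f'\neq0$ on $\overline{\mathbb{D}}$, satisfying the equation pointwise on $\partial\mathbb{D}$. *)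

theory Defs
  imports "HOL-Complex_Analysis.Complex_Analysis"
begin

definition locally_univalent_maps :: "(complex \<Rightarrow> complex) set" where
  "locally_univalent_maps =
     {g. g analytic_on cball 0 1 \<and> g 0 = 0 \<and>
         deriv g 0 \<in> \<real> \<and> Re (deriv g 0) > 0 \<and>
         (\<forall>\<zeta>\<in>cball 0 1. deriv g \<zeta> \<noteq> 0)}"

text \<open>Curves are written \<open>f t \<zeta>\<close> for $f(\zeta,t)$. The time derivative is
  relative to the time set \<open>I\<close>, hence one-sided at an end point of \<open>I\<close>.\<close>

definition time_deriv :: "real set \<Rightarrow> (real \<Rightarrow> complex \<Rightarrow> complex) \<Rightarrow> real \<Rightarrow> complex \<Rightarrow> complex" where
  "time_deriv I f t \<zeta> = vector_derivative (\<lambda>s. f s \<zeta>) (at t within I)"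

text \<open>Smoothness of a curve with values in the functions analytic near the closed unit disk,
  for the inductive limit topology of this space: over every compact set of times the functions are
  analytic on a common disk of radius \<open>r > 1\<close>, and the curve is differentiable with
  continuous derivative in the topology of uniform convergence there. The class is
  $C^1$: since \<open>q\<close> in the Polubarinova-Galin equation is merely continuous, no further
  time derivatives need exist.\<close>

definition smooth_analytic_curve :: "real set \<Rightarrow> (real \<Rightarrow> complex \<Rightarrow> complex) \<Rightarrow> bool" where
  "smooth_analytic_curve I f \<longleftrightarrow>
     (\<forall>J. compact J \<and> J \<subseteq> I \<longrightarrow>
       (\<exists>r>1. \<forall>t\<in>J.
          f t analytic_on cball 0 r \<and>
          uniform_limit (cball 0 r) (\<lambda>s \<zeta>. (f s \<zeta> - f t \<zeta>) /\<^sub>R (s - t)) (time_deriv I f t)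
            (at t within I) \<and>
          uniform_limit (cball 0 r) (time_deriv I f) (time_deriv I f t) (at t within I)))"

definition locally_univalent_PG_solution ::
    "real set \<Rightarrow> (real \<Rightarrow> real) \<Rightarrow> (real \<Rightarrow> complex \<Rightarrow> complex) \<Rightarrow> bool" where
  "locally_univalent_PG_solution I q f \<longleftrightarrow>
     smooth_analytic_curve I f \<and>
     (\<forall>t\<in>I. f t \<in> locally_univalent_maps) \<and>
     (\<forall>t\<in>I. \<forall>\<zeta>\<in>sphere 0 1.
        Re (time_deriv I f t \<zeta> * cnj (\<zeta> * deriv (f t) \<zeta>)) = q t)"

end

theory Submission
  imports Defs
begin

text \<open>Since \<open>f' \<noteq> 0\<close>, the function \<open>1 / |f'|\<^sup>2\<close> is subharmonic, so the equation makes
  \<open>a = f'(0)\<close> satisfy \<open>(a\<^sup>2)' \<ge> 2 * q\<close>, whereas the area (counted with multiplicity) divided by \<open>pi\<close>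
  grows exactly at the rate \<open>2 * q\<close>. Hence the area is at most a constant times \<open>a\<^sup>2\<close>, so the
  Taylor coefficients of \<open>f / a\<close> are bounded uniformly in time, and all \<open>f t\<close> are injective on one
  and the same disk around \<open>0\<close>. On the other hand two points with equal images can be continued in time
  (this is the Loewner subordination \<open>f s = f t \<circ> \<phi>\<close>), and by Harnack's inequality they
  move towards \<open>0\<close> because the area tends to infinity. Thus noninjectivity at any time would enter that disk.\<close>

text \<open>The rates have to match. Let B be the area divided by pi. A pair moves towards 0 at a
  relative speed given by the real part of \<open>herglotz\<close>, which at 0 is at least q/a^2 >=
  q/B, half the logarithmic derivative of B. Harnack keeps a fixed fraction of this on a disk of
  radius r0 < 1, so the radius can be made to decay like a negative power of B: injected area, not
  elapsed time, drives the pair to 0. Two obstacles shape the proof. Harnack's factor vanishes on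
  the unit circle, where a pair may lie at the outset; one short step, using a lower bound for the
  real part that is valid up to the circle, moves it inside. Moreover, the two points might merge in
  a limit; as f' has no zeros, injectivity near any point is uniform over nearby times, which
  excludes this. Continuation is therefore a real induction over a time interval, applied to the
  mere existence of a pair in a disk of prescribed radius; neither trajectories nor subordination
  maps are constructed.\<close>

section \<open>Functions with real part bounded below, and a criterion for injectivity\<close>

lemma holomorphic_Re_ge_on_cball:
  assumes holo: "p holomorphic_on cball 0 1"
    and bd: "\<And>z. norm z = 1 \<Longrightarrow> Re (p z) \<ge> m"
    and z: "norm z \<le> 1"
  shows "Re (p z) \<ge> m"
proof -
  have *: "(\<lambda>z. - p z) holomorphic_on cball 0 1"
    by (intro holomorphic_intros holo)
  have "Re (- p z) \<le> - m"
  proof (rule maximum_real_frontier[where S = "cball 0 1" and f = "\<lambda>z. - p z" and \<xi> = z])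
    show "(\<lambda>z. - p z) holomorphic_on interior (cball 0 1)"
      by (rule holomorphic_on_subset[OF *]) auto
    show "continuous_on (closure (cball 0 1)) (\<lambda>z. - p z)"
      using holomorphic_on_imp_continuous_on[OF *] by simp
  qed (use bd z in auto)
  then show ?thesis by simp
qed

text \<open>The Cayley transform \<open>w = (p - p 0) / (p + cnj (p 0))\<close> carries the right
  half-plane to the unit disk and vanishes at 0, so the Schwarz lemma gives
  \<open>norm (w z) \<le> norm z\<close>. Solving back for the real part of \<open>p z\<close>
  yields the bound.\<close>

lemma harnack_Re_lower:
  assumes holo: "p holomorphic_on ball 0 1"
    and pos: "\<And>z. norm z < 1 \<Longrightarrow> Re (p z) > 0"
    and z: "norm z < 1"
  shows "Re (p z) \<ge> Re (p 0) * (1 - norm z) / (1 + norm z)"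
proof -
  define x y where "x = Re (p 0)" and "y = Im (p 0)"
  have x: "x > 0" using pos[of 0] by (simp add: x_def)
  define N where "N = (\<lambda>z. p z - (of_real x + \<i> * of_real y))"
  define D where "D = (\<lambda>z. p z + (of_real x - \<i> * of_real y))"
  define w where "w = (\<lambda>z. N z / D z)"
  have Dnz: "D u \<noteq> 0" if "norm u < 1" for u
  proof -
    have "Re (D u) > 0" using pos[OF that] x by (simp add: D_def)
    then show ?thesis by auto
  qed
  have holw: "w holomorphic_on ball 0 1"
    unfolding w_def N_def D_def
    by (intro holomorphic_intros holo) (use Dnz in \<open>auto simp: D_def\<close>)
  have w0: "w 0 = 0" by (simp add: w_def N_def x_def y_def complex_eq[symmetric])
  have wlt: "norm (w u) < 1" if "norm u < 1" for u
  proof -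
    have "(norm (N u))\<^sup>2 < (norm (D u))\<^sup>2"
    proof -
      have "(norm (D u))\<^sup>2 - (norm (N u))\<^sup>2 = 4 * x * Re (p u)"
        unfolding cmod_power2 N_def D_def by (simp add: power2_eq_square algebra_simps)
      then show ?thesis using mult_pos_pos[OF x pos[OF that]] by linarith
    qed
    then have "norm (N u) < norm (D u)" by (rule power2_less_imp_less) simp
    then show ?thesis using Dnz[OF that] by (simp add: w_def norm_divide)
  qed
  have wz: "norm (w z) \<le> norm z"
    by (rule Schwarz_Lemma(1)[OF holw w0 wlt z])
  \<comment> \<open>This is the real part of \<open>p = i y + x (1 + w) / (1 - w)\<close>, cleared
    of denominators.\<close>
  have eqz: "Re (p z) * (norm (1 - w z))\<^sup>2 = x * (1 - (norm (w z))\<^sup>2)"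
  proof -
    have D: "D z \<noteq> 0" by (rule Dnz[OF z])
    have 1: "1 - w z = of_real (2 * x) / D z"
      using D by (simp add: w_def field_simps) (simp add: N_def D_def algebra_simps)
    have n1: "(norm (1 - w z))\<^sup>2 * (norm (D z))\<^sup>2 = 4 * x\<^sup>2"
      using D x by (simp add: 1 norm_divide power_divide norm_mult power_mult_distrib)
    have n2: "(norm (w z))\<^sup>2 * (norm (D z))\<^sup>2 = (norm (N z))\<^sup>2"
      using D by (simp add: w_def norm_divide power_divide)
    have d: "(norm (D z))\<^sup>2 - (norm (N z))\<^sup>2 = 4 * x * Re (p z)"
      unfolding cmod_power2 N_def D_def by (simp add: power2_eq_square algebra_simps)
    have "Re (p z) * (norm (1 - w z))\<^sup>2 * (norm (D z))\<^sup>2 = x * (1 - (norm (w z))\<^sup>2) * (norm (D z))\<^sup>2"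
    proof -
      have "Re (p z) * (norm (1 - w z))\<^sup>2 * (norm (D z))\<^sup>2 = x * (4 * x * Re (p z))"
        by (simp add: mult.assoc n1) (simp add: power2_eq_square)
      also have "\<dots> = x * ((norm (D z))\<^sup>2 - (norm (w z))\<^sup>2 * (norm (D z))\<^sup>2)"
        by (simp only: d n2)
      finally show ?thesis by (simp add: algebra_simps)
    qed
    then show ?thesis using D by simp
  qed
  define s where "s = norm (w z)"
  have s: "0 \<le> s" "s < 1" "s \<le> norm z" using wlt[OF z] wz by (auto simp: s_def)
  have le: "(norm (1 - w z))\<^sup>2 \<le> (1 + s)\<^sup>2"
    using norm_triangle_ineq4[of 1 "w z"] by (intro power_mono) (auto simp: s_def)
  have "x * (1 - s) * (1 + s) = Re (p z) * (norm (1 - w z))\<^sup>2"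
    unfolding eqz s_def by (simp add: power2_eq_square algebra_simps)
  also have "\<dots> \<le> Re (p z) * (1 + s)\<^sup>2"
    using le pos[OF z] by (intro mult_left_mono) auto
  finally have "x * (1 - s) \<le> Re (p z) * (1 + s)"
    using s by (simp add: power2_eq_square mult.assoc[symmetric])
  then have "x * ((1 - s) / (1 + s)) \<le> Re (p z)"
    using s by (simp add: field_simps)
  moreover have "(1 - norm z) / (1 + norm z) \<le> (1 - s) / (1 + s)"
    using s z by (intro frac_le) auto
  then have "x * ((1 - norm z) / (1 + norm z)) \<le> x * ((1 - s) / (1 + s))"
    using x by (intro mult_left_mono) auto
  ultimately show ?thesis by (simp add: x_def)
qed

text \<open>After subtraction of the linear map with slope \<open>c\<close>, a
  \<open>k\<close>-Lipschitz function remains, which is too weak to cancel that map. It is applied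
  near 0 with a radius uniform in time, and near an arbitrary point for all times close to a given
  one.\<close>

lemma inj_on_deriv_near_const:
  fixes g :: "complex \<Rightarrow> complex"
  assumes S: "convex S"
    and der: "\<And>z. z \<in> S \<Longrightarrow> (g has_field_derivative g' z) (at z)"
    and near: "\<And>z. z \<in> S \<Longrightarrow> norm (g' z - c) \<le> k" and k: "k < norm c"
  shows "inj_on g S"
proof (rule inj_onI)
  fix u v assume uv: "u \<in> S" "v \<in> S" "g u = g v"
  have "norm ((g u - c * u) - (g v - c * v)) \<le> k * norm (u - v)"
  proof (rule field_differentiable_bound[OF S, where f' = "\<lambda>z. g' z - c"])
    show "((\<lambda>z. g z - c * z) has_field_derivative g' z - c) (at z within S)" if "z \<in> S" for z
      by (rule derivative_eq_intros has_field_derivative_at_within[OF der[OF that]] refl)+ simp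
  qed (use uv near in auto)
  also have "(g u - c * u) - (g v - c * v) = - (c * (u - v))"
    using uv by (simp add: algebra_simps)
  finally have "(norm c - k) * norm (u - v) \<le> 0"
    unfolding norm_minus_cancel norm_mult by (simp add: left_diff_distrib)
  then show "u = v" using k by (simp add: mult_le_0_iff)
qed

section \<open>Circle means and area\<close>

text \<open>Integration against the normalized angle instead of dz: the integrands contain
  conjugates, and no factor \<open>2 * pi * \<i> * z\<close> has to be carried along.\<close>

definition circle_mean :: "(complex \<Rightarrow> complex) \<Rightarrow> complex" where
  "circle_mean F = integral {0..1} (\<lambda>x. F (circlepath 0 1 x))"

lemma circlepath_01_in_sphere [simp]: "norm (circlepath 0 1 x) = 1"
  by (simp add: circlepath)

lemma continuous_on_circlepath_compose:
  assumes "continuous_on (sphere 0 1) F"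
  shows "continuous_on A (\<lambda>x. F (circlepath 0 1 x))"
  by (rule continuous_on_compose2[OF assms]) (auto simp: circlepath intro!: continuous_intros)

lemma circle_mean_integrable:
  fixes F :: "complex \<Rightarrow> complex"
  assumes "continuous_on (sphere 0 1) F"
  shows "(\<lambda>x. F (circlepath 0 1 x)) integrable_on {0..1}"
  by (rule integrable_continuous_real[OF continuous_on_circlepath_compose[OF assms]])

lemma circle_mean_add:
  assumes "continuous_on (sphere 0 1) F" "continuous_on (sphere 0 1) G"
  shows "circle_mean (\<lambda>z. F z + G z) = circle_mean F + circle_mean G"
  unfolding circle_mean_def
  by (intro integral_add circle_mean_integrable assms)

lemma circle_mean_diff:
  assumes "continuous_on (sphere 0 1) F" "continuous_on (sphere 0 1) G"
  shows "circle_mean (\<lambda>z. F z - G z) = circle_mean F - circle_mean G"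
  unfolding circle_mean_def
  by (intro integral_diff circle_mean_integrable assms)

lemma circle_mean_cmult: "circle_mean (\<lambda>z. c * F z) = c * circle_mean F"
  unfolding circle_mean_def by simp

lemma circle_mean_const [simp]: "circle_mean (\<lambda>z. c) = c"
  unfolding circle_mean_def by simp

lemma circle_mean_cong: "(\<And>z. norm z = 1 \<Longrightarrow> F z = G z) \<Longrightarrow> circle_mean F = circle_mean G"
  unfolding circle_mean_def by (intro integral_cong) auto

lemma circle_mean_sum:
  assumes "finite A" "\<And>a. a \<in> A \<Longrightarrow> continuous_on (sphere 0 1) (F a)"
  shows "circle_mean (\<lambda>z. \<Sum>a\<in>A. F a z) = (\<Sum>a\<in>A. circle_mean (F a))"
  unfolding circle_mean_def
  by (intro integral_sum circle_mean_integrable assms)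

lemma circle_mean_norm_le:
  assumes "continuous_on (sphere 0 1) F" "\<And>z. norm z = 1 \<Longrightarrow> norm (F z) \<le> b"
  shows "norm (circle_mean F) \<le> b"
  using integral_bound[of 0 1 "\<lambda>x. F (circlepath 0 1 x)" b]
  by (simp add: circle_mean_def continuous_on_circlepath_compose assms)

lemma circle_mean_Re:
  assumes "continuous_on (sphere 0 1) F"
  shows "circle_mean (\<lambda>z. of_real (Re (F z))) = of_real (Re (circle_mean F))"
proof -
  have i: "((\<lambda>x. F (circlepath 0 1 x)) has_integral circle_mean F) {0..1}"
    unfolding circle_mean_def by (intro integrable_integral circle_mean_integrable assms)
  have "((\<lambda>x. complex_of_real (Re (F (circlepath 0 1 x)))) has_integral of_real (Re (circle_mean F))) {0..1}"
    using has_integral_linear[OF has_integral_linear[OF i bounded_linear_Re]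
        bounded_linear_of_real[where 'a=complex]]
    by (simp add: o_def)
  then show ?thesis unfolding circle_mean_def by (rule integral_unique)
qed

lemma circle_mean_cnj:
  assumes "continuous_on (sphere 0 1) F"
  shows "circle_mean (\<lambda>z. cnj (F z)) = cnj (circle_mean F)"
  unfolding circle_mean_def
  using integral_linear[OF circle_mean_integrable[OF assms] bounded_linear_cnj] by (simp add: o_def)

lemma circle_mean_tendsto:
  assumes lim: "uniform_limit (sphere 0 1) F G A"
    and F: "\<forall>\<^sub>F s in A. continuous_on (sphere 0 1) (F s)"
    and G: "continuous_on (sphere 0 1) G"
  shows "((\<lambda>s. circle_mean (F s)) \<longlongrightarrow> circle_mean G) A"
proof (rule tendstoI)
  fix e :: real assume e: "e > 0"
  have "\<forall>\<^sub>F s in A. \<forall>z\<in>sphere 0 1. dist (F s z) (G z) < e / 2"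
    using uniform_limitD[OF lim, of "e/2"] e by simp
  with F show "\<forall>\<^sub>F s in A. dist (circle_mean (F s)) (circle_mean G) < e"
  proof eventually_elim
    case (elim s)
    have "norm (circle_mean (\<lambda>z. F s z - G z)) \<le> e / 2"
      by (rule circle_mean_norm_le)
        (use elim G in \<open>auto intro!: continuous_intros simp: dist_norm less_imp_le\<close>)
    then show ?case
      using e by (simp add: circle_mean_diff elim G dist_norm)
  qed
qed

text \<open>On the unit circle \<open>cnj z\<close> is \<open>1 / z\<close>, and dz is
  \<open>2 * pi * \<i> * z\<close> dx, so this is Cauchy's formula for the Taylor
  coefficients.\<close>

lemma circle_mean_coeff:
  assumes holo: "v holomorphic_on ball 0 r" and r: "r > 1"
  shows "circle_mean (\<lambda>z. cnj (z ^ n) * v z) = (deriv ^^ n) v 0 / fact n"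
proof -
  have "((\<lambda>u. v u / (u - 0) ^ Suc n) has_contour_integral
      (2 * pi * \<i>) / fact n * (deriv ^^ n) v 0) (circlepath 0 1)"
    by (rule Cauchy_has_contour_integral_higher_derivative_circlepath)
      (use r in \<open>auto intro!: holomorphic_on_imp_continuous_on intro: holomorphic_on_subset[OF holo]\<close>)
  then have "((\<lambda>x. v (circlepath 0 1 x) / (circlepath 0 1 x) ^ Suc n *
        vector_derivative (circlepath 0 1) (at x within {0..1}))
      has_integral (2 * pi * \<i>) / fact n * (deriv ^^ n) v 0) {0..1}"
    by (simp add: has_contour_integral_def)
  then have "((\<lambda>x. 2 * pi * \<i> * (cnj (circlepath 0 1 x ^ n) * v (circlepath 0 1 x)))
      has_integral (2 * pi * \<i>) * ((deriv ^^ n) v 0 / fact n)) {0..1}"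
  proof (rule has_integral_eq_rhs[OF has_integral_eq, rotated])
    fix x :: real assume x: "x \<in> {0..1}"
    define g where "g = circlepath 0 1 x"
    have g: "norm g = 1" "g \<noteq> 0" unfolding g_def using circlepath_01_in_sphere[of x] by force+
    have d: "vector_derivative (circlepath 0 1) (at x within {0..1}) = 2 * pi * \<i> * g"
      using x unfolding g_def by (subst vector_derivative_circlepath01) (simp_all add: circlepath)
    have "cnj g * g = 1" using complex_norm_square[of g] g by (simp add: mult.commute)
    then have "g ^ n * cnj g ^ n = 1" by (simp add: power_mult_distrib[symmetric] mult.commute)
    then have "v g / g ^ Suc n * (2 * pi * \<i> * g) = 2 * pi * \<i> * (cnj (g ^ n) * v g)"
      using g by (simp add: field_simps)
    then show "v (circlepath 0 1 x) / circlepath 0 1 x ^ Suc n *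
          vector_derivative (circlepath 0 1) (at x within {0..1}) =
         2 * pi * \<i> * (cnj (circlepath 0 1 x ^ n) * v (circlepath 0 1 x))"
      unfolding d g_def .
  qed simp
  then have "circle_mean (\<lambda>z. 2 * pi * \<i> * (cnj (z ^ n) * v z)) = (2 * pi * \<i>) * ((deriv ^^ n) v 0 / fact n)"
    unfolding circle_mean_def by (rule integral_unique)
  then have "2 * pi * \<i> * circle_mean (\<lambda>z. cnj (z ^ n) * v z) = 2 * pi * \<i> * ((deriv ^^ n) v 0 / fact n)"
    by (simp only: circle_mean_cmult)
  then show ?thesis by (rule mult_left_cancel[THEN iffD1, rotated]) simp
qed

lemma uniform_limit_taylor_sphere:
  assumes holo: "g holomorphic_on ball 0 r" and r: "r > 1"
  shows "uniform_limit (sphere 0 1) (\<lambda>N z. \<Sum>k<N. (deriv ^^ k) g 0 / fact k * z ^ k) g sequentially"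
proof -
  define c where "c = (\<lambda>k. (deriv ^^ k) g 0 / fact k)"
  have sums: "(\<lambda>k. c k * z ^ k) sums g z" if "norm z < r" for z
    using holomorphic_power_series[OF holo, of z] that by (simp add: c_def)
  \<comment> \<open>Convergence at a radius strictly between 1 and \<open>r\<close> forces absolute
    summability at radius 1, as the M-test requires.\<close>
  have "summable (\<lambda>k. c k * (of_real ((1 + r) / 2)) ^ k)"
    using sums[of "of_real ((1+r)/2)"] r by (intro sums_summable) (auto simp: norm_divide simp del: of_real_divide)
  then have "summable (\<lambda>k. norm (c k * 1 ^ k))"
    by (rule powser_insidea) (use r in \<open>simp add: norm_divide del: of_real_divide\<close>)
  then have s: "summable (\<lambda>k. norm (c k))" by simp
  have "uniform_limit (sphere 0 1) (\<lambda>N z. \<Sum>k<N. c k * z ^ k) (\<lambda>z. \<Sum>k. c k * z ^ k) sequentially"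
    by (rule Weierstrass_m_test[OF _ s]) (simp add: norm_mult norm_power)
  then show ?thesis
    by (rule uniform_limit_cong'[THEN iffD1, rotated -1])
      (use sums r in \<open>auto simp: sums_iff c_def\<close>)
qed

text \<open>\<open>circle_area g\<close> is \<open>1 / pi\<close> times the area of \<open>g ` ball 0 1\<close>, counted with multiplicity,
  written as a boundary integral by Green's theorem.\<close>

definition circle_area :: "(complex \<Rightarrow> complex) \<Rightarrow> real" where
  "circle_area g = Re (circle_mean (\<lambda>z. cnj (g z) * (z * deriv g z)))"

text \<open>Parseval: the area is the sum of \<open>n * (norm c\<^sub>n)\<^sup>2\<close>.\<close>

lemma coeff_le_circle_area:
  assumes holo: "g holomorphic_on ball 0 r" and r: "r > 1"
  shows "n * (norm ((deriv ^^ n) g 0 / fact n))\<^sup>2 \<le> circle_area g"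
proof -
  define c where "c = (\<lambda>k. (deriv ^^ k) g 0 / fact k)"
  define v where "v = (\<lambda>z. z * deriv g z)"
  have holg': "deriv g holomorphic_on ball 0 r" by (intro holomorphic_deriv holo) auto
  have holv: "v holomorphic_on ball 0 r" unfolding v_def by (intro holomorphic_intros holg')
  have cont: "continuous_on (sphere 0 1) h" if "h holomorphic_on ball 0 r" for h :: "complex \<Rightarrow> complex"
    by (intro holomorphic_on_imp_continuous_on holomorphic_on_subset[OF that]) (use r in auto)
  \<comment> \<open>Multiplication by \<open>z\<close> shifts the coefficients of
    \<open>deriv g\<close> by one; hence index 0 is treated apart, where
    \<open>v 0 = 0\<close>.\<close>
  have vk: "circle_mean (\<lambda>z. cnj (z ^ k) * v z) = k * c k" for k
  proof (cases k)
    case 0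
    then show ?thesis using circle_mean_coeff[OF holv r, of 0] by (simp add: v_def)
  next
    case (Suc m)
    have "circle_mean (\<lambda>z. cnj (z ^ k) * v z) = circle_mean (\<lambda>z. cnj (z ^ m) * deriv g z)"
    proof (rule circle_mean_cong)
      fix z :: complex assume "norm z = 1"
      then have "cnj z * z = 1" using complex_norm_square[of z] by (simp add: mult.commute)
      then show "cnj (z ^ k) * v z = cnj (z ^ m) * deriv g z"
        by (simp add: Suc v_def mult_ac)
    qed
    also have "\<dots> = (deriv ^^ m) (deriv g) 0 / fact m"
      by (rule circle_mean_coeff[OF holg' r])
    also have "\<dots> = k * c k"
      by (simp add: c_def Suc funpow_Suc_right del: funpow.simps of_nat_Suc)
    finally show ?thesis .
  qed
  \<comment> \<open>Only the conjugated factor is replaced by Taylor polynomials. Each summand is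
    then a coefficient extraction from the exact \<open>v\<close>, and no double series
    arises.\<close>
  define S where "S = (\<lambda>N z. \<Sum>k<N. c k * z ^ k)"
  have cs: "continuous_on (sphere 0 1) (S N)" for N unfolding S_def by (intro continuous_intros)
  have m: "circle_mean (\<lambda>z. cnj (S N z) * v z) = of_real (\<Sum>k<N. k * (norm (c k))\<^sup>2)" for N
  proof -
    have "circle_mean (\<lambda>z. cnj (S N z) * v z) = circle_mean (\<lambda>z. \<Sum>k<N. cnj (c k) * (cnj (z ^ k) * v z))"
      by (simp add: S_def sum_distrib_left mult_ac)
    also have "\<dots> = (\<Sum>k<N. circle_mean (\<lambda>z. cnj (c k) * (cnj (z ^ k) * v z)))"
      by (rule circle_mean_sum) (auto intro!: continuous_intros cont[OF holv])
    also have "\<dots> = (\<Sum>k<N. cnj (c k) * (k * c k))"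
      by (simp only: circle_mean_cmult vk)
    also have "\<dots> = of_real (\<Sum>k<N. k * (norm (c k))\<^sup>2)"
      by (simp add: complex_norm_square mult_ac del: of_real_power)
    finally show ?thesis .
  qed
  have "((\<lambda>N. circle_mean (\<lambda>z. cnj (S N z) * v z)) \<longlongrightarrow> circle_mean (\<lambda>z. cnj (g z) * v z)) sequentially"
  proof (rule circle_mean_tendsto)
    have b: "bounded (h ` sphere 0 1)" if "continuous_on (sphere 0 1) h" for h :: "complex \<Rightarrow> complex"
      using that by (intro compact_imp_bounded compact_continuous_image) auto
    have u: "uniform_limit (sphere 0 1) S g sequentially"
      using uniform_limit_taylor_sphere[OF holo r] by (simp add: S_def c_def)
    have u': "uniform_limit (sphere 0 1) (\<lambda>N z. cnj (S N z)) (\<lambda>z. cnj (g z)) sequentially"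
      by (rule bounded_linear.uniform_limit[OF bounded_linear_cnj u])
    show "uniform_limit (sphere 0 1) (\<lambda>N z. cnj (S N z) * v z) (\<lambda>z. cnj (g z) * v z) sequentially"
      by (rule uniform_lim_mult[OF u' uniform_limit_const])
        (auto intro!: b continuous_intros cont[OF holv] cont[OF holo])
  qed (auto intro!: always_eventually continuous_intros cs cont[OF holv] cont[OF holo])
  then have lim: "((\<lambda>N. Re (circle_mean (\<lambda>z. cnj (S N z) * v z))) \<longlongrightarrow> circle_area g) sequentially"
    unfolding circle_area_def v_def by (intro tendsto_intros)
  show ?thesis
  proof (rule tendsto_lowerbound[OF lim])
    show "\<forall>\<^sub>F N in sequentially. n * (norm ((deriv ^^ n) g 0 / fact n))\<^sup>2 \<le> Re (circle_mean (\<lambda>z. cnj (S N z) * v z))"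
      using eventually_gt_at_top[of n]
    proof eventually_elim
      case (elim N)
      have "n * (norm (c n))\<^sup>2 \<le> (\<Sum>k<N. k * (norm (c k))\<^sup>2)"
        by (rule member_le_sum) (use elim in auto)
      then show ?case unfolding m c_def by simp
    qed
  qed simp
qed

text \<open>The angular derivative of \<open>cnj f * g\<close> has mean 0 by periodicity. Angular
  differentiation is \<open>2 * pi * \<i>\<close> times \<open>z\<close> d/dz, and conjugation flips
  the sign of this factor, so both sides come out with the same sign. It serves to remove the space
  derivative from \<open>fdot\<close>.\<close>

lemma circle_mean_by_parts:
  assumes f: "f holomorphic_on ball 0 r" and g: "g holomorphic_on ball 0 r" and r: "r > 1"
  shows "circle_mean (\<lambda>z. cnj (f z) * (z * deriv g z)) = circle_mean (\<lambda>z. cnj (z * deriv f z) * g z)"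
proof -
  have cont: "continuous_on (sphere 0 1) h" if "h holomorphic_on ball 0 r" for h :: "complex \<Rightarrow> complex"
    by (intro holomorphic_on_imp_continuous_on holomorphic_on_subset[OF that]) (use r in auto)
  note hol = f g holomorphic_deriv[OF f] holomorphic_deriv[OF g]
  define H where "H = (\<lambda>z. cnj (f z) * (z * deriv g z) - cnj (z * deriv f z) * g z)"
  have d: "((\<lambda>x. h (circlepath 0 1 x)) has_vector_derivative
      2 * pi * \<i> * (circlepath 0 1 x * deriv h (circlepath 0 1 x))) (at x within {0..1})"
    if "h holomorphic_on ball 0 r" for h x
  proof -
    have 1: "(circlepath 0 1 has_vector_derivative 2 * pi * \<i> * circlepath 0 1 x) (at x within {0..1})"
      using has_vector_derivative_circlepath[of 0 1 x "{0..1}"] by (simp add: circlepath)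
    have 2: "(h has_field_derivative deriv h (circlepath 0 1 x)) (at (circlepath 0 1 x))"
      by (rule holomorphic_derivI[OF that]) (use r in auto)
    show ?thesis
      using field_vector_diff_chain_within[OF 1 has_field_derivative_at_within[OF 2]]
      by (simp add: o_def mult_ac)
  qed
  have "((\<lambda>x. cnj (f (circlepath 0 1 x)) * (2 * pi * \<i> * (circlepath 0 1 x * deriv g (circlepath 0 1 x)))
       + cnj (2 * pi * \<i> * (circlepath 0 1 x * deriv f (circlepath 0 1 x))) * g (circlepath 0 1 x))
      has_integral cnj (f (circlepath 0 1 1)) * g (circlepath 0 1 1)
        - cnj (f (circlepath 0 1 0)) * g (circlepath 0 1 0)) {0..1}"
    by (intro fundamental_theorem_of_calculus has_vector_derivative_mult d f g has_vector_derivative_cnj) simp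
  then have "((\<lambda>x. (2 * pi * \<i>) * H (circlepath 0 1 x)) has_integral 0) {0..1}"
    by (rule has_integral_eq_rhs[OF has_integral_eq, rotated])
      (simp_all add: H_def algebra_simps circlepath)
  then have "circle_mean (\<lambda>z. (2 * pi * \<i>) * H z) = 0"
    unfolding circle_mean_def by (rule integral_unique)
  then have "circle_mean H = 0" by (simp add: circle_mean_cmult)
  then show ?thesis
    unfolding H_def
    by (subst (asm) circle_mean_diff) (auto intro!: continuous_intros cont[OF f] cont[OF g] cont[OF hol(3)] cont[OF hol(4)])
qed

text \<open>The coefficients of \<open>deriv g\<close> are at most \<open>K * a * 2 ^ n\<close> with
  \<open>a = norm (deriv g 0)\<close>. For \<open>norm z \<le> 1 / 4\<close> the geometric series
  bounds the variation of \<open>deriv g\<close> by \<open>4 * a * K * norm z\<close>, and the 8 in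
  the radius brings this down to \<open>a / 2\<close>. What matters is that the radius depends on
  \<open>K\<close> alone.\<close>

lemma inj_on_ball_of_circle_area:
  assumes holo: "g holomorphic_on ball 0 r" and r: "r > 1"
    and K: "K \<ge> 1" and area: "circle_area g \<le> K * (norm (deriv g 0))\<^sup>2"
    and nz: "deriv g 0 \<noteq> 0"
  shows "inj_on g (ball 0 (1 / (8 * K)))"
proof (rule inj_on_deriv_near_const[where c = "deriv g 0" and k = "norm (deriv g 0) / 2"])
  define a where "a = norm (deriv g 0)"
  have a: "a > 0" using nz by (simp add: a_def)
  have holg': "deriv g holomorphic_on ball 0 r" by (intro holomorphic_deriv holo) auto
  have sub: "ball 0 (1 / (8 * K)) \<subseteq> ball 0 r"
  proof (rule subset_ball)
    have "1 / (8 * K) \<le> 1" using K by simp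
    then show "1 / (8 * K) \<le> r" using r by linarith
  qed
  show "(g has_field_derivative deriv g z) (at z)" if "z \<in> ball 0 (1 / (8 * K))" for z
    by (rule holomorphic_derivI[OF holo open_ball subsetD[OF sub that]])
  define d where "d = (\<lambda>n. (deriv ^^ n) (deriv g) 0 / fact n)"
  have d_le: "norm (d n) \<le> K * a * 2 ^ n" for n
  proof -
    define c where "c = norm ((deriv ^^ Suc n) g 0 / fact (Suc n))"
    have dc: "norm (d n) = Suc n * c"
      by (simp add: d_def c_def norm_divide norm_mult funpow_Suc_right del: funpow.simps of_nat_Suc)
    have "Suc n * c\<^sup>2 \<le> K * a\<^sup>2"
      using coeff_le_circle_area[OF holo r, of "Suc n"] area by (simp add: c_def a_def)
    then have "Suc n * (Suc n * c\<^sup>2) \<le> Suc n * (K * a\<^sup>2)" by (intro mult_left_mono) auto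
    then have "(norm (d n))\<^sup>2 \<le> Suc n * (K * a\<^sup>2)"
      by (simp add: dc power_mult_distrib power2_eq_square mult_ac)
    also have "\<dots> \<le> (Suc n)\<^sup>2 * (K\<^sup>2 * a\<^sup>2)"
    proof (intro mult_mono)
      show "real (Suc n) \<le> real ((Suc n)\<^sup>2)" unfolding of_nat_le_iff by (simp add: power2_eq_square)
      show "K \<le> K\<^sup>2" using K by (simp add: power2_eq_square)
    qed (use K in auto)
    also have "\<dots> = (Suc n * K * a)\<^sup>2" by (simp add: power_mult_distrib)
    finally have "norm (d n) \<le> Suc n * K * a"
      by (rule power2_le_imp_le) (use a K in auto)
    also have "\<dots> \<le> 2 ^ n * K * a"
    proof -
      have "Suc n \<le> 2 ^ n" by (simp add: Suc_leI)
      then have "real (Suc n) \<le> 2 ^ n" by (metis of_nat_le_iff of_nat_numeral of_nat_power)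
      then show ?thesis using a K by (intro mult_right_mono) auto
    qed
    finally show ?thesis by (simp add: mult_ac)
  qed
  show "norm (deriv g z - deriv g 0) \<le> norm (deriv g 0) / 2" if z: "z \<in> ball 0 (1 / (8 * K))" for z
  proof -
    have zK: "norm z < 1 / (8 * K)" using z by simp
    have z4: "norm z \<le> 1 / 4"
    proof -
      have "1 / (8 * K) \<le> 1 / 4" using K by (intro divide_left_mono) auto
      then show ?thesis using zK by linarith
    qed
    have "(\<lambda>n. d n * z ^ n) sums deriv g z"
      using holomorphic_power_series[OF holg' subsetD[OF sub z]] by (simp add: d_def)
    then have s: "(\<lambda>n. d (Suc n) * z ^ Suc n) sums (deriv g z - deriv g 0)"
      by (subst sums_Suc_iff) (simp add: d_def)
    have geo: "(\<lambda>n. K * a * (2 * norm z) * (2 * norm z) ^ n) sums (K * a * (2 * norm z) * (1 / (1 - 2 * norm z)))"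
      using z4 by (intro sums_mult geometric_sums) auto
    have "norm (deriv g z - deriv g 0) \<le> K * a * (2 * norm z) * (1 / (1 - 2 * norm z))"
    proof -
      have "norm (\<Sum>n. d (Suc n) * z ^ Suc n) \<le> (\<Sum>n. K * a * (2 * norm z) * (2 * norm z) ^ n)"
      proof (rule norm_suminf_le[OF _ sums_summable[OF geo]])
        fix n
        have "norm (d (Suc n) * z ^ Suc n) \<le> K * a * 2 ^ Suc n * norm z ^ Suc n"
          unfolding norm_mult norm_power by (intro mult_right_mono d_le) auto
        then show "norm (d (Suc n) * z ^ Suc n) \<le> K * a * (2 * norm z) * (2 * norm z) ^ n"
          by (simp add: power_mult_distrib mult_ac)
      qed
      then show ?thesis using s geo by (simp add: sums_iff)
    qed
    also have "\<dots> \<le> K * a * (2 * norm z) * 2"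
      using z4 a K by (intro mult_left_mono) (auto simp: field_simps)
    also have "\<dots> = (K * norm z) * (4 * a)" by simp
    also have "\<dots> \<le> (1 / 8) * (4 * a)"
      using zK K a by (intro mult_right_mono) (auto simp: field_simps)
    finally show ?thesis by (simp add: a_def)
  qed
qed (use nz in auto)

section \<open>Uniform limits of derivatives, and one-sided calculus in time\<close>

text \<open>Cauchy's estimate on circles whose radius is half the gap \<open>R - \<rho>\<close>, so
  that they stay inside the larger ball uniformly in the centre.\<close>

lemma uniform_limit_deriv_on_smaller_ball:
  assumes lim: "uniform_limit (ball 0 R) g l F"
    and holg: "\<forall>\<^sub>F s in F. g s holomorphic_on ball 0 R"
    and holl: "l holomorphic_on ball 0 R"
    and \<rho>: "\<rho> < R"
  shows "uniform_limit (ball 0 \<rho>) (\<lambda>s. deriv (g s)) (deriv l) F"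
proof (rule uniform_limitI)
  fix e :: real assume e: "e > 0"
  define d where "d = (R - \<rho>) / 2"
  have d: "d > 0" using \<rho> by (simp add: d_def)
  have "\<forall>\<^sub>F s in F. \<forall>z\<in>ball 0 R. dist (g s z) (l z) < e / 2 * d"
    using uniform_limitD[OF lim, of "e / 2 * d"] e d by simp
  with holg show "\<forall>\<^sub>F s in F. \<forall>z\<in>ball 0 \<rho>. dist (deriv (g s) z) (deriv l z) < e"
  proof eventually_elim
    case (elim s)
    show ?case
    proof
      fix z :: complex assume z: "z \<in> ball 0 \<rho>"
      have sub: "cball z d \<subseteq> ball 0 R"
      proof
        fix w assume "w \<in> cball z d"
        then show "w \<in> ball 0 R"
          using z norm_triangle_sub[of w z] \<rho> by (auto simp: d_def dist_norm norm_minus_commute field_simps)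
      qed
      have zR: "z \<in> ball 0 R" using sub[THEN subsetD, of z] d by simp
      have h: "(\<lambda>w. g s w - l w) holomorphic_on ball 0 R" by (intro holomorphic_intros elim holl)
      have "norm ((deriv ^^ 1) (\<lambda>w. g s w - l w) z) \<le> fact 1 * (e / 2 * d) / d ^ 1"
      proof (rule Cauchy_inequality)
        show "(\<lambda>w. g s w - l w) holomorphic_on ball z d"
          by (rule holomorphic_on_subset[OF h]) (use sub in auto)
        show "continuous_on (cball z d) (\<lambda>w. g s w - l w)"
          by (intro holomorphic_on_imp_continuous_on holomorphic_on_subset[OF h] sub)
        show "norm (g s x - l x) \<le> e / 2 * d" if "norm (z - x) = d" for x
        proof -
          have "x \<in> ball 0 R" using sub that by (auto simp: dist_norm)
          then show ?thesis using elim by (auto simp: dist_norm less_imp_le)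
        qed
      qed (use d in auto)
      moreover have "deriv (\<lambda>w. g s w - l w) z = deriv (g s) z - deriv l z"
        by (intro deriv_diff holomorphic_on_imp_differentiable_at[where s = "ball 0 R"] elim holl zR) auto
      ultimately show "dist (deriv (g s) z) (deriv l z) < e"
        using d e by (simp add: dist_norm)
    qed
  qed
qed

lemma trivial_limit_within_atLeast [simp]: "t \<ge> 0 \<Longrightarrow> at (t::real) within {0..} \<noteq> bot"
proof -
  assume t: "t \<ge> 0"
  have "at_right t \<noteq> bot" by simp
  moreover have "at_right t \<le> at t within {0..}" using t by (intro at_le) auto
  ultimately show "at t within {0..} \<noteq> bot" using bot_unique by metis
qed

lemma at_right_le_at_within_atLeast: "t \<ge> 0 \<Longrightarrow> at_right t \<le> at (t::real) within {0..}"
  by (intro at_le) auto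

text \<open>Near \<open>t\<close> the quotients are bounded by \<open>\<bar>B\<bar> + 1\<close> on
  all of \<open>A\<close>, so the increments are of order \<open>s - t\<close> uniformly.\<close>

lemma uniform_limit_of_difference_quotient:
  fixes f :: "real \<Rightarrow> 'b \<Rightarrow> 'a::real_normed_vector"
  assumes lim: "uniform_limit A (\<lambda>s z. (f s z - f t z) /\<^sub>R (s - t)) l (at t within I)"
    and bd: "\<And>z. z \<in> A \<Longrightarrow> norm (l z) \<le> B"
  shows "uniform_limit A f (f t) (at t within I)"
proof (rule uniform_limitI)
  fix e :: real assume e: "e > 0"
  have 1: "\<forall>\<^sub>F s in at t within I. \<forall>z\<in>A. dist ((f s z - f t z) /\<^sub>R (s - t)) (l z) < 1"
    using uniform_limitD[OF lim, of 1] by simp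
  have "((\<lambda>s. \<bar>s - t\<bar> * (\<bar>B\<bar> + 1)) \<longlongrightarrow> \<bar>t - t\<bar> * (\<bar>B\<bar> + 1)) (at t within I)"
    by (intro tendsto_intros)
  then have 2: "\<forall>\<^sub>F s in at t within I. \<bar>s - t\<bar> * (\<bar>B\<bar> + 1) < e"
    by (rule order_tendstoD) (use e in simp)
  have 3: "\<forall>\<^sub>F s in at t within I. s \<noteq> t" by (simp add: eventually_at_filter)
  show "\<forall>\<^sub>F s in at t within I. \<forall>z\<in>A. dist (f s z) (f t z) < e"
    using 1 2 3
  proof eventually_elim
    case (elim s)
    show ?case
    proof
      fix z assume z: "z \<in> A"
      define d where "d = (f s z - f t z) /\<^sub>R (s - t)"
      have "norm d \<le> norm (l z) + dist d (l z)"
        using norm_triangle_ineq[of "l z" "d - l z"] by (simp add: dist_norm)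
      also have "\<dots> \<le> \<bar>B\<bar> + 1" using bd[OF z] elim(1) z by (auto simp: d_def intro!: add_mono less_imp_le)
      finally have "norm d \<le> \<bar>B\<bar> + 1" .
      moreover have "f s z - f t z = (s - t) *\<^sub>R d" using elim(3) by (simp add: d_def)
      ultimately have "norm (f s z - f t z) \<le> \<bar>s - t\<bar> * (\<bar>B\<bar> + 1)"
        by (simp add: mult_left_mono)
      then show "dist (f s z) (f t z) < e" using elim(2) by (simp add: dist_norm)
    qed
  qed
qed

lemma le_of_nonneg_derivative:
  fixes u :: "real \<Rightarrow> real"
  assumes der: "\<And>s. s \<ge> 0 \<Longrightarrow> (u has_real_derivative u' s) (at s within {0..})"
    and nonneg: "\<And>s. s \<ge> 0 \<Longrightarrow> u' s \<ge> 0" and ab: "0 \<le> a" "a \<le> b"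
  shows "u a \<le> u b"
proof (rule DERIV_nonneg_imp_increasing_open[OF ab(2)])
  fix x assume x: "a < x" "x < b"
  have "at x within {0..} = at x" by (rule at_within_interior) (use x ab in auto)
  then show "\<exists>y. (u has_real_derivative y) (at x) \<and> y \<ge> 0"
    using der[of x] nonneg[of x] x ab by auto
next
  have "continuous_on {0..} u" by (rule DERIV_continuous_on[OF der]) auto
  then show "continuous_on {a..b} u" by (rule continuous_on_subset) (use ab in auto)
qed

section \<open>Solutions of the Polubarinova-Galin equation as Loewner chains\<close>

locale global_PG_solution =
  fixes f :: "real \<Rightarrow> complex \<Rightarrow> complex" and q :: "real \<Rightarrow> real"
  assumes q_pos: "t \<ge> 0 \<Longrightarrow> q t > 0"
    and injected_unbounded: "filterlim (\<lambda>t. integral {0..t} q) at_top at_top"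
    and solution: "locally_univalent_PG_solution {0..} q f"
begin

abbreviation fdot :: "real \<Rightarrow> complex \<Rightarrow> complex" where
  "fdot \<equiv> time_deriv {0..} f"

lemma f_zero: "t \<ge> 0 \<Longrightarrow> f t 0 = 0"
  and f_analytic: "t \<ge> 0 \<Longrightarrow> f t analytic_on cball 0 1"
  and deriv_zero_real: "t \<ge> 0 \<Longrightarrow> deriv (f t) 0 = of_real (Re (deriv (f t) 0))"
  and deriv_zero_pos: "t \<ge> 0 \<Longrightarrow> Re (deriv (f t) 0) > 0"
  and deriv_nonzero: "t \<ge> 0 \<Longrightarrow> norm z \<le> 1 \<Longrightarrow> deriv (f t) z \<noteq> 0"
  using solution
  by (auto simp: locally_univalent_PG_solution_def locally_univalent_maps_def)

lemma PG_equation: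
  "t \<ge> 0 \<Longrightarrow> norm z = 1 \<Longrightarrow> Re (fdot t z * cnj (z * deriv (f t) z)) = q t"
  using solution by (auto simp: locally_univalent_PG_solution_def)

text \<open>Unpacks the smoothness of the curve at one time, on one open disk. The statements about
  space derivatives and the holomorphy of \<open>fdot t\<close> are consequences of uniform
  convergence of holomorphic functions.\<close>

lemma local_regularity:
  assumes t: "t \<ge> 0"
  obtains r where "r > 1"
    "f t holomorphic_on ball 0 r" "fdot t holomorphic_on ball 0 r"
    "\<forall>\<^sub>F s in at t within {0..}. f s holomorphic_on ball 0 r"
    "uniform_limit (ball 0 r) (\<lambda>s z. (f s z - f t z) /\<^sub>R (s - t)) (fdot t) (at t within {0..})"
    "uniform_limit (ball 0 r) (\<lambda>s z. (deriv (f s) z - deriv (f t) z) /\<^sub>R (s - t)) (deriv (fdot t))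
       (at t within {0..})"
    "uniform_limit (ball 0 r) f (f t) (at t within {0..})"
    "uniform_limit (ball 0 r) (\<lambda>s. deriv (f s)) (deriv (f t)) (at t within {0..})"
proof -
  have sm: "smooth_analytic_curve {0..} f"
    using solution by (simp add: locally_univalent_PG_solution_def)
  \<comment> \<open>\<open>{0..t+1}\<close> is compact and a neighbourhood of \<open>t\<close>
    relative to the half-line, so a single radius serves all nearby times.\<close>
  obtain R where R: "R > 1" and an: "\<And>s. s \<in> {0..t+1} \<Longrightarrow> f s analytic_on cball 0 R"
    and lim: "uniform_limit (cball 0 R) (\<lambda>s z. (f s z - f t z) /\<^sub>R (s - t)) (fdot t) (at t within {0..})"
    using sm[unfolded smooth_analytic_curve_def, rule_format, of "{0..t+1}"] t by fastforce
  have hol: "f s holomorphic_on cball 0 R" if "s \<in> {0..t+1}" for s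
    by (rule analytic_imp_holomorphic[OF an[OF that]])
  have evt: "\<forall>\<^sub>F s in at t within {0..}. s \<in> {0..t+1}"
    unfolding eventually_at by (intro exI[of _ 1]) (auto simp: dist_real_def)
  have evhol: "\<forall>\<^sub>F s in at t within {0..}. f s holomorphic_on cball 0 R"
    using evt by eventually_elim (rule hol)
  have ft: "f t holomorphic_on cball 0 R" by (rule hol) (use t in auto)
  have evdq: "\<forall>\<^sub>F s in at t within {0..}. (\<lambda>z. (f s z - f t z) /\<^sub>R (s - t)) holomorphic_on cball 0 R"
    using evhol by eventually_elim (auto simp: scaleR_conv_of_real intro!: holomorphic_intros ft)
  obtain fdc: "continuous_on (cball 0 R) (fdot t)" and fdh: "fdot t holomorphic_on ball 0 R"
  proof (rule holomorphic_uniform_limit[OF _ lim])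
    show "\<forall>\<^sub>F s in at t within {0..}. continuous_on (cball 0 R) (\<lambda>z. (f s z - f t z) /\<^sub>R (s - t)) \<and>
             (\<lambda>z. (f s z - f t z) /\<^sub>R (s - t)) holomorphic_on ball 0 R"
      using evdq by eventually_elim (auto intro: holomorphic_on_imp_continuous_on holomorphic_on_subset)
  qed (use t in auto)
  \<comment> \<open>A smaller radius leaves room for Cauchy's estimate and places the disk in a
    compact set on which \<open>fdot t\<close> and its derivative are bounded.\<close>
  define r where "r = (1 + R) / 2"
  have r: "1 < r" "r < R" using R by (auto simp: r_def)
  have ball_R: "h holomorphic_on ball 0 R" if "h holomorphic_on cball 0 R" for h
    using that by (rule holomorphic_on_subset) auto
  have ball_r: "h holomorphic_on ball 0 r" if "h holomorphic_on ball 0 R" for h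
    using that by (rule holomorphic_on_subset) (use r in auto)
  have limR: "uniform_limit (ball 0 R) (\<lambda>s z. (f s z - f t z) /\<^sub>R (s - t)) (fdot t) (at t within {0..})"
    by (rule uniform_limit_on_subset[OF lim]) auto
  have limr: "uniform_limit (ball 0 r) (\<lambda>s z. (f s z - f t z) /\<^sub>R (s - t)) (fdot t) (at t within {0..})"
    by (rule uniform_limit_on_subset[OF lim]) (use r in auto)
  have "uniform_limit (ball 0 r) (\<lambda>s. deriv (\<lambda>z. (f s z - f t z) /\<^sub>R (s - t))) (deriv (fdot t)) (at t within {0..})"
    by (rule uniform_limit_deriv_on_smaller_ball[OF limR _ fdh r(2)])
      (use evdq in \<open>eventually_elim, auto intro: ball_R\<close>)
  moreover have "\<forall>\<^sub>F s in at t within {0..}. \<forall>z\<in>ball 0 r. deriv (\<lambda>z. (f s z - f t z) /\<^sub>R (s - t)) z =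
      (deriv (f s) z - deriv (f t) z) /\<^sub>R (s - t)"
    using evhol
  proof eventually_elim
    case (elim s)
    show ?case
    proof
      fix z :: complex assume "z \<in> ball 0 r"
      then have z: "z \<in> ball 0 R" using r by auto
      note d = holomorphic_derivI[OF ball_R[OF elim] open_ball z] holomorphic_derivI[OF ball_R[OF ft] open_ball z]
      show "deriv (\<lambda>z. (f s z - f t z) /\<^sub>R (s - t)) z = (deriv (f s) z - deriv (f t) z) /\<^sub>R (s - t)"
        unfolding scaleR_conv_of_real
        by (intro DERIV_imp_deriv DERIV_cmult DERIV_diff d)
    qed
  qed
  ultimately have limd: "uniform_limit (ball 0 r) (\<lambda>s z. (deriv (f s) z - deriv (f t) z) /\<^sub>R (s - t)) (deriv (fdot t))
       (at t within {0..})"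
    by (rule uniform_limit_cong[THEN iffD1, rotated 2]) auto
  have bd: "\<exists>B. \<forall>z\<in>ball 0 r. norm (h z) \<le> B" if "h holomorphic_on ball 0 R" for h :: "complex \<Rightarrow> complex"
  proof -
    have "compact (h ` cball 0 r)"
      by (intro compact_continuous_image holomorphic_on_imp_continuous_on holomorphic_on_subset[OF that])
        (use r in auto)
    then have "bounded (h ` ball 0 r)"
      by (rule bounded_subset[OF compact_imp_bounded]) auto
    then show ?thesis by (auto simp: bounded_iff)
  qed
  obtain B1 where B1: "\<And>z. z \<in> ball 0 r \<Longrightarrow> norm (fdot t z) \<le> B1" using bd[OF fdh] by blast
  obtain B2 where B2: "\<And>z. z \<in> ball 0 r \<Longrightarrow> norm (deriv (fdot t) z) \<le> B2"
    using bd[OF holomorphic_deriv[OF fdh open_ball]] by blast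
  show thesis
  proof (rule that[OF r(1)])
    show "\<forall>\<^sub>F s in at t within {0..}. f s holomorphic_on ball 0 r"
      using evhol by eventually_elim (intro ball_r ball_R)
    show "uniform_limit (ball 0 r) f (f t) (at t within {0..})"
      by (rule uniform_limit_of_difference_quotient[OF limr B1])
    show "uniform_limit (ball 0 r) (\<lambda>s. deriv (f s)) (deriv (f t)) (at t within {0..})"
      by (rule uniform_limit_of_difference_quotient[OF limd B2])
  qed (use limr limd ball_r ball_R ft fdh in auto)
qed


section \<open>The Loewner equation and bounds for the real part of its driving function\<close>

lemma fdot_zero: assumes t: "t \<ge> 0" shows "fdot t 0 = 0"
proof -
  obtain r where r: "r > 1"
    and lim: "uniform_limit (ball 0 r) (\<lambda>s z. (f s z - f t z) /\<^sub>R (s - t)) (fdot t) (at t within {0..})"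
    using t by (rule local_regularity)
  have "((\<lambda>s. (f s 0 - f t 0) /\<^sub>R (s - t)) \<longlongrightarrow> fdot t 0) (at t within {0..})"
    by (rule tendsto_uniform_limitI[OF lim]) (use r in auto)
  moreover have "((\<lambda>s. (f s 0 - f t 0) /\<^sub>R (s - t)) \<longlongrightarrow> 0) (at t within {0..})"
    by (rule tendsto_eventually) (auto simp: eventually_at_filter f_zero t)
  ultimately show ?thesis
    using t by (intro tendsto_unique[OF trivial_limit_within_atLeast])
qed

text \<open>In terms of \<open>herglotz\<close> the Polubarinova-Galin equation is the Loewner equation
  \<open>fdot = z * f' * herglotz\<close>, with \<open>Re herglotz = q / |f'|\<^sup>2\<close> on the circle.\<close>

definition herglotz :: "real \<Rightarrow> complex \<Rightarrow> complex" where
  "herglotz t z = (if z = 0 then deriv (fdot t) 0 else fdot t z / z) / deriv (f t) z"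

lemma fdot_eq_herglotz:
  assumes "t \<ge> 0" "norm z \<le> 1"
  shows "fdot t z = z * deriv (f t) z * herglotz t z"
  using deriv_nonzero[OF assms] fdot_zero[OF assms(1)] by (simp add: herglotz_def)

lemma deriv_holomorphic_on_cball: "t \<ge> 0 \<Longrightarrow> deriv (f t) holomorphic_on cball 0 1"
  by (intro analytic_imp_holomorphic analytic_deriv f_analytic)

lemma herglotz_holomorphic:
  assumes t: "t \<ge> 0" shows "herglotz t holomorphic_on cball 0 1"
proof -
  obtain r where r: "r > 1" and h: "fdot t holomorphic_on ball 0 r"
    using t by (rule local_regularity)
  \<comment> \<open>Removable singularity at 0, because \<open>fdot t 0 = 0\<close>.\<close>
  have "(\<lambda>z. if z = 0 then deriv (fdot t) 0 else (fdot t z - fdot t 0) / (z - 0)) holomorphic_on ball 0 r"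
    by (rule pole_lemma_open[OF h open_ball])
  then have "(\<lambda>z. if z = 0 then deriv (fdot t) 0 else fdot t z / z) holomorphic_on cball 0 1"
    by (rule holomorphic_on_subset[OF holomorphic_transform]) (use r fdot_zero[OF t] in auto)
  then show ?thesis
    unfolding herglotz_def
    by (intro holomorphic_on_divide deriv_holomorphic_on_cball t) (use deriv_nonzero[OF t] in auto)
qed

lemma herglotz_on_circle:
  assumes t: "t \<ge> 0" and z: "norm z = 1"
  shows "Re (herglotz t z) = q t / (norm (deriv (f t) z))\<^sup>2"
proof -
  define v where "v = z * deriv (f t) z"
  have v: "norm v = norm (deriv (f t) z)" using z by (simp add: v_def norm_mult)
  have "q t = Re (herglotz t z * (v * cnj v))"
    using PG_equation[OF t z] fdot_eq_herglotz[OF t, of z] z by (simp add: v_def mult_ac)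
  also have "v * cnj v = of_real ((norm (deriv (f t) z))\<^sup>2)"
    unfolding complex_norm_square[symmetric] v ..
  finally show ?thesis
    using deriv_nonzero[OF t, of z] z by (simp add: field_simps)
qed

text \<open>\<open>deriv (f t)\<close> is bounded on the circle, and the minimum principle carries
  the resulting bound inside. Unlike Harnack's bound it does not degenerate at the circle; the price
  is a constant that depends on \<open>t\<close>.\<close>

lemma Re_herglotz_bounded_below:
  assumes t: "t \<ge> 0"
  obtains m where "m > 0" "\<And>z. norm z \<le> 1 \<Longrightarrow> Re (herglotz t z) \<ge> m"
proof -
  have "continuous_on (sphere 0 1) (deriv (f t))"
    by (intro holomorphic_on_imp_continuous_on holomorphic_on_subset[OF deriv_holomorphic_on_cball] t) auto
  then have "bounded (deriv (f t) ` sphere 0 1)"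
    by (intro compact_imp_bounded compact_continuous_image) auto
  then obtain B where B: "B > 0" "\<And>z. norm z = 1 \<Longrightarrow> norm (deriv (f t) z) \<le> B"
    by (auto simp: bounded_pos)
  show thesis
  proof (rule that)
    show "q t / B\<^sup>2 > 0" using q_pos[OF t] B by simp
    show "Re (herglotz t z) \<ge> q t / B\<^sup>2" if z: "norm z \<le> 1" for z
    proof (rule holomorphic_Re_ge_on_cball[OF herglotz_holomorphic[OF t] _ z])
      fix w :: complex assume w: "norm w = 1"
      have "q t / B\<^sup>2 \<le> q t / (norm (deriv (f t) w))\<^sup>2"
        using B(1) B(2)[OF w] deriv_nonzero[OF t, of w] w q_pos[OF t]
        by (intro divide_left_mono power_mono) auto
      then show "q t / B\<^sup>2 \<le> Re (herglotz t w)" by (simp add: herglotz_on_circle t w)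
    qed
  qed
qed

lemma Re_herglotz_pos:
  assumes "t \<ge> 0" "norm z \<le> 1" shows "Re (herglotz t z) > 0"
  using Re_herglotz_bounded_below[OF assms(1)] assms(2) by (metis less_le_trans)

text \<open>With \<open>h = 1 / f'\<close>, the function \<open>|h|\<^sup>2\<close> dominates the harmonic function
  \<open>|h 0|\<^sup>2 + 2 * Re (cnj (h 0) * (h - h 0))\<close>, with equality at \<open>0\<close>.\<close>

lemma Re_herglotz_zero_ge:
  assumes t: "t \<ge> 0" shows "Re (herglotz t 0) \<ge> q t / (norm (deriv (f t) 0))\<^sup>2"
proof -
  define h where "h = (\<lambda>z. inverse (deriv (f t) z))"
  \<comment> \<open>The subtracted term is \<open>q t\<close> times a holomorphic function whose
    real part is the harmonic minorant of \<open>(norm (h z))\<^sup>2\<close>. On the circle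
    \<open>Re (p z)\<close> becomes \<open>q t * (norm (h z - h 0))\<^sup>2\<close>.\<close>
  define p where "p = (\<lambda>z. herglotz t z - of_real (q t) * (of_real ((norm (h 0))\<^sup>2) + 2 * (cnj (h 0) * (h z - h 0))))"
  have hh: "h holomorphic_on cball 0 1"
    unfolding h_def
    by (intro holomorphic_on_inverse deriv_holomorphic_on_cball t) (use deriv_nonzero[OF t] in auto)
  have "p holomorphic_on cball 0 1"
    unfolding p_def by (intro holomorphic_intros hh herglotz_holomorphic t)
  moreover have "Re (p z) \<ge> 0" if z: "norm z = 1" for z
  proof -
    have "Re (herglotz t z) = q t * (norm (h z))\<^sup>2"
      by (simp add: herglotz_on_circle[OF t z] h_def norm_inverse power_inverse divide_inverse)
    moreover have "Re (p z) = Re (herglotz t z) - q t * ((norm (h 0))\<^sup>2 + 2 * Re (cnj (h 0) * (h z - h 0)))"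
    proof -
      have "Re (of_real x * (of_real y + 2 * w)) = x * (y + 2 * Re w)" for x y :: real and w by simp
      then show ?thesis unfolding p_def minus_complex.simps by metis
    qed
    ultimately have "Re (p z) = q t * ((norm (h z))\<^sup>2 - (norm (h 0))\<^sup>2 - 2 * Re (cnj (h 0) * (h z - h 0)))"
      by (simp only:) (simp only: right_diff_distrib distrib_left)
    also have "(norm (h z))\<^sup>2 - (norm (h 0))\<^sup>2 - 2 * Re (cnj (h 0) * (h z - h 0)) = (norm (h z - h 0))\<^sup>2"
      unfolding cmod_power2 by (simp add: power2_eq_square algebra_simps)
    also have "q t * (norm (h z - h 0))\<^sup>2 \<ge> 0" using q_pos[OF t] by simp
    finally show ?thesis .
  qed
  ultimately have "Re (p 0) \<ge> 0" by (rule holomorphic_Re_ge_on_cball) auto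
  then have "Re (herglotz t 0) \<ge> q t * (norm (h 0))\<^sup>2"
    by (simp add: p_def del: of_real_power)
  also have "(norm (h 0))\<^sup>2 = 1 / (norm (deriv (f t) 0))\<^sup>2"
    by (simp add: h_def norm_inverse power_inverse divide_inverse)
  finally show ?thesis by simp
qed

section \<open>Growth of the derivative at 0 and of the area\<close>

text \<open>By the normalization the modulus equals the real part, which is linear in
  \<open>f\<close>. The rate is the Loewner equation differentiated in space at 0.\<close>

lemma has_real_derivative_norm_deriv_zero:
  assumes t: "t \<ge> 0"
  shows "((\<lambda>s. norm (deriv (f s) 0)) has_real_derivative
    norm (deriv (f t) 0) * Re (herglotz t 0)) (at t within {0..})"
proof -
  obtain r where r: "r > 1"
    and lim: "uniform_limit (ball 0 r) (\<lambda>s z. (deriv (f s) z - deriv (f t) z) /\<^sub>R (s - t)) (deriv (fdot t))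
       (at t within {0..})"
    using t by (rule local_regularity)
  have n: "norm (deriv (f s) 0) = Re (deriv (f s) 0)" if "s \<ge> 0" for s
    using deriv_zero_real[OF that] deriv_zero_pos[OF that] by (metis abs_of_pos norm_of_real)
  have "((\<lambda>s. (deriv (f s) 0 - deriv (f t) 0) /\<^sub>R (s - t)) \<longlongrightarrow> deriv (fdot t) 0) (at t within {0..})"
    by (rule tendsto_uniform_limitI[OF lim]) (use r in auto)
  then have "((\<lambda>s. Re ((deriv (f s) 0 - deriv (f t) 0) /\<^sub>R (s - t))) \<longlongrightarrow> Re (deriv (fdot t) 0)) (at t within {0..})"
    by (rule tendsto_Re)
  moreover have "Re (deriv (fdot t) 0) = norm (deriv (f t) 0) * Re (herglotz t 0)"
  proof -
    have "deriv (fdot t) 0 = of_real (Re (deriv (f t) 0)) * herglotz t 0"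
      using deriv_nonzero[OF t, of 0] deriv_zero_real[OF t] by (simp add: herglotz_def)
    then show ?thesis by (simp add: n t)
  qed
  moreover have "\<forall>\<^sub>F s in at t within {0..}. Re ((deriv (f s) 0 - deriv (f t) 0) /\<^sub>R (s - t)) =
      (norm (deriv (f s) 0) - norm (deriv (f t) 0)) / (s - t)"
    by (auto simp: eventually_at_filter n t divide_inverse_commute)
  ultimately show ?thesis
    unfolding has_field_derivative_iff by (simp add: tendsto_cong)
qed

text \<open>Conservation of mass. After integration by parts the derivative is twice the mean of the
  left-hand side of the Polubarinova-Galin equation, which is constant on the circle.\<close>

lemma has_real_derivative_circle_area:
  assumes t: "t \<ge> 0"
  shows "((\<lambda>s. circle_area (f s)) has_real_derivative 2 * q t) (at t within {0..})"
proof -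
  obtain r where r: "r > 1"
    and ft: "f t holomorphic_on ball 0 r" and fd: "fdot t holomorphic_on ball 0 r"
    and ev: "\<forall>\<^sub>F s in at t within {0..}. f s holomorphic_on ball 0 r"
    and lim: "uniform_limit (ball 0 r) (\<lambda>s z. (f s z - f t z) /\<^sub>R (s - t)) (fdot t) (at t within {0..})"
    and limd: "uniform_limit (ball 0 r) (\<lambda>s z. (deriv (f s) z - deriv (f t) z) /\<^sub>R (s - t)) (deriv (fdot t))
       (at t within {0..})"
    and limf': "uniform_limit (ball 0 r) (\<lambda>s. deriv (f s)) (deriv (f t)) (at t within {0..})"
    using t by (rule local_regularity)
  have sub: "sphere 0 1 \<subseteq> ball 0 r" using r by auto
  note lims = uniform_limit_on_subset[OF lim sub] uniform_limit_on_subset[OF limd sub]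
    uniform_limit_on_subset[OF limf' sub]
  have cont: "continuous_on (sphere 0 1) h" if "h holomorphic_on ball 0 r" for h :: "complex \<Rightarrow> complex"
    by (intro holomorphic_on_imp_continuous_on holomorphic_on_subset[OF that] sub)
  note conts = cont[OF ft] cont[OF fd] cont[OF holomorphic_deriv[OF ft open_ball]]
    cont[OF holomorphic_deriv[OF fd open_ball]]
  have b: "bounded (h ` sphere 0 1)" if "continuous_on (sphere 0 1) h" for h :: "complex \<Rightarrow> complex"
    using that by (intro compact_imp_bounded compact_continuous_image) auto
  define dq where "dq = (\<lambda>s z. (f s z - f t z) /\<^sub>R (s - t))"
  define dq' where "dq' = (\<lambda>s z. (deriv (f s) z - deriv (f t) z) /\<^sub>R (s - t))"
  \<comment> \<open>The discrete product rule: with one factor at time \<open>s\<close> and the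
    other at \<open>t\<close>, it telescopes exactly to the difference quotient of the area
    integrand.\<close>
  define F where "F = (\<lambda>s z. cnj (dq s z) * (z * deriv (f s) z) + cnj (f t z) * (z * dq' s z))"
  define G where "G = (\<lambda>z. cnj (fdot t z) * (z * deriv (f t) z) + cnj (f t z) * (z * deriv (fdot t) z))"
  have "((\<lambda>s. circle_mean (F s)) \<longlongrightarrow> circle_mean G) (at t within {0..})"
  proof (rule circle_mean_tendsto)
    show "continuous_on (sphere 0 1) G" unfolding G_def by (intro continuous_intros conts)
    show "\<forall>\<^sub>F s in at t within {0..}. continuous_on (sphere 0 1) (F s)"
      using ev unfolding F_def dq_def dq'_def
      by eventually_elim (intro continuous_intros conts cont, auto intro!: holomorphic_deriv)
    show "uniform_limit (sphere 0 1) F G (at t within {0..})"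
      unfolding F_def G_def dq_def dq'_def
      by (intro uniform_limit_add uniform_lim_mult bounded_linear.uniform_limit[OF bounded_linear_cnj]
          lims uniform_limit_const b continuous_intros conts)
  qed
  then have 1: "((\<lambda>s. Re (circle_mean (F s))) \<longlongrightarrow> Re (circle_mean G)) (at t within {0..})"
    by (rule tendsto_Re)
  have "\<forall>\<^sub>F s in at t within {0..}. s \<noteq> t" by (simp add: eventually_at_filter)
  with ev have 2: "\<forall>\<^sub>F s in at t within {0..}.
      Re (circle_mean (F s)) = (circle_area (f s) - circle_area (f t)) / (s - t)"
  proof eventually_elim
    case (elim s)
    define X where "X = (\<lambda>u z. cnj (f u z) * (z * deriv (f u) z))"
    have "F s = (\<lambda>z. of_real (inverse (s - t)) * (X s z - X t z))"
      by (rule ext) (simp add: F_def dq_def dq'_def X_def scaleR_conv_of_real right_diff_distrib mult_ac)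
    then have "circle_mean (F s) = of_real (inverse (s - t)) * circle_mean (\<lambda>z. X s z - X t z)"
      by (simp only: circle_mean_cmult)
    also have "circle_mean (\<lambda>z. X s z - X t z) = circle_mean (X s) - circle_mean (X t)"
      unfolding X_def
      by (intro circle_mean_diff continuous_intros conts cont[OF elim(1)] cont[OF holomorphic_deriv[OF elim(1) open_ball]])
    finally have c: "circle_mean (F s) = of_real (inverse (s - t)) * (circle_mean (X s) - circle_mean (X t))" .
    have "Re (of_real x * w) = x * Re w" for x :: real and w by simp
    then show ?case unfolding c by (simp only: circle_area_def X_def divide_inverse_commute minus_complex.simps)
  qed
  have 3: "Re (circle_mean G) = 2 * q t"
  proof -
    define v where "v = (\<lambda>z. z * deriv (f t) z)"
    have v: "continuous_on (sphere 0 1) v" unfolding v_def by (intro continuous_intros conts)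
    have "circle_mean G = circle_mean (\<lambda>z. cnj (fdot t z) * v z) + circle_mean (\<lambda>z. cnj (f t z) * (z * deriv (fdot t) z))"
      unfolding G_def v_def by (intro circle_mean_add continuous_intros conts)
    also have "circle_mean (\<lambda>z. cnj (f t z) * (z * deriv (fdot t) z)) = circle_mean (\<lambda>z. cnj (v z) * fdot t z)"
      unfolding v_def by (rule circle_mean_by_parts[OF ft fd r])
    also have "circle_mean (\<lambda>z. cnj (fdot t z) * v z) = cnj (circle_mean (\<lambda>z. cnj (v z) * fdot t z))"
      by (subst circle_mean_cnj[symmetric]) (auto intro!: continuous_intros v conts simp: mult.commute)
    finally have "Re (circle_mean G) = 2 * Re (circle_mean (\<lambda>z. cnj (v z) * fdot t z))" by simp
    also have "Re (circle_mean (\<lambda>z. cnj (v z) * fdot t z)) = q t"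
    proof -
      have "complex_of_real (Re (circle_mean (\<lambda>z. cnj (v z) * fdot t z))) =
          circle_mean (\<lambda>z. of_real (Re (cnj (v z) * fdot t z)))"
        by (rule circle_mean_Re[symmetric]) (intro continuous_intros v conts)
      also have "\<dots> = circle_mean (\<lambda>z. of_real (q t))"
        by (rule circle_mean_cong) (use PG_equation[OF t] in \<open>simp add: v_def mult.commute\<close>)
      finally show ?thesis by simp
    qed
    finally show ?thesis .
  qed
  show ?thesis
    unfolding has_field_derivative_iff using tendsto_cong[OF 2] 1 3 by simp
qed

text \<open>The term \<open>n = 1\<close> of the Parseval sum. It turns the lower bound q/a^2 at 0
  into q divided by the area, which integrates to a logarithm.\<close>

lemma norm_deriv_zero_sq_le_circle_area:
  assumes t: "t \<ge> 0" shows "(norm (deriv (f t) 0))\<^sup>2 \<le> circle_area (f t)"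
proof -
  obtain r where "r > 1" "f t holomorphic_on ball 0 r"
    using t by (rule local_regularity)
  from coeff_le_circle_area[OF this(2) this(1), of 1] show ?thesis by simp
qed

lemma circle_area_pos:
  assumes t: "t \<ge> 0" shows "circle_area (f t) > 0"
proof -
  have "0 < (norm (deriv (f t) 0))\<^sup>2" using deriv_nonzero[OF t, of 0] by simp
  then show ?thesis using norm_deriv_zero_sq_le_circle_area[OF t] by linarith
qed

lemma circle_area_eq:
  assumes t: "t \<ge> 0" shows "circle_area (f t) = circle_area (f 0) + 2 * integral {0..t} q"
proof -
  have "((\<lambda>s. 2 * q s) has_integral circle_area (f t) - circle_area (f 0)) {0..t}"
  proof (rule fundamental_theorem_of_calculus[OF t])
    fix s assume s: "s \<in> {0..t}"
    then have "((\<lambda>s. circle_area (f s)) has_real_derivative 2 * q s) (at s within {0..t})"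
      by (intro has_field_derivative_subset[OF has_real_derivative_circle_area]) auto
    then show "((\<lambda>s. circle_area (f s)) has_vector_derivative 2 * q s) (at s within {0..t})"
      by (simp add: has_real_derivative_iff_has_vector_derivative)
  qed
  then have "integral {0..t} (\<lambda>s. 2 * q s) = circle_area (f t) - circle_area (f 0)"
    by (rule integral_unique)
  then show ?thesis by simp
qed

lemma circle_area_at_top: "filterlim (\<lambda>t. circle_area (f t)) at_top at_top"
proof -
  have "filterlim (\<lambda>t. circle_area (f 0) + 2 * integral {0..t} q) at_top at_top"
    by (intro filterlim_tendsto_add_at_top[OF tendsto_const]
        filterlim_tendsto_pos_mult_at_top[OF tendsto_const] injected_unbounded) auto
  moreover have "\<forall>\<^sub>F t in at_top. circle_area (f t) = circle_area (f 0) + 2 * integral {0..t} q"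
    using eventually_ge_at_top[of 0] by eventually_elim (rule circle_area_eq)
  ultimately show ?thesis by (simp add: filterlim_cong)
qed

text \<open>\<open>a = f'(0)\<close> satisfies \<open>(a\<^sup>2)' \<ge> 2 * q\<close>, where \<open>2 * q\<close> is the rate of growth of the area.\<close>

lemma circle_area_le_norm_deriv_zero_sq:
  obtains K where "K \<ge> 1" "\<And>t. t \<ge> 0 \<Longrightarrow> circle_area (f t) \<le> K * (norm (deriv (f t) 0))\<^sup>2"
proof
  define a where "a = (\<lambda>t. norm (deriv (f t) 0))"
  define B where "B = (\<lambda>t. circle_area (f t))"
  \<comment> \<open>The ratio of area to \<open>a\<^sup>2\<close> at time 0. As
    \<open>a\<^sup>2\<close> increases and gains at least as much as the area, the ratio never
    exceeds this value.\<close>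
  define K where "K = B 0 / (a 0)\<^sup>2"
  have a0: "a 0 > 0" using deriv_nonzero[of 0 0] by (simp add: a_def)
  have aB: "(a 0)\<^sup>2 \<le> B 0" using norm_deriv_zero_sq_le_circle_area[of 0] by (simp add: a_def B_def)
  then show K: "K \<ge> 1" using a0 by (simp add: K_def)
  show "circle_area (f t) \<le> K * (norm (deriv (f t) 0))\<^sup>2" if t: "t \<ge> 0" for t
  proof -
    have da: "(a has_real_derivative a s * Re (herglotz s 0)) (at s within {0..})" if "s \<ge> 0" for s
      using has_real_derivative_norm_deriv_zero[OF that] by (simp add: a_def)
    have da2: "((\<lambda>s. (a s)\<^sup>2) has_real_derivative 2 * ((a s)\<^sup>2 * Re (herglotz s 0))) (at s within {0..})"
      if "s \<ge> 0" for s
      by (rule derivative_eq_intros da[OF that] refl)+ (simp add: power2_eq_square)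
    have ge: "q s \<le> (a s)\<^sup>2 * Re (herglotz s 0)" if "s \<ge> 0" for s
      using Re_herglotz_zero_ge[OF that] deriv_nonzero[OF that, of 0] by (simp add: a_def field_simps)
    have 1: "(a 0)\<^sup>2 - B 0 \<le> (a t)\<^sup>2 - B t"
    proof (rule le_of_nonneg_derivative[OF _ _ order_refl t])
      fix s :: real assume s: "s \<ge> 0"
      show "((\<lambda>s. (a s)\<^sup>2 - B s) has_real_derivative 2 * ((a s)\<^sup>2 * Re (herglotz s 0)) - 2 * q s) (at s within {0..})"
        unfolding B_def by (intro DERIV_diff da2 s has_real_derivative_circle_area)
    qed (use ge in auto)
    have 2: "(a 0)\<^sup>2 \<le> (a t)\<^sup>2"
    proof (rule le_of_nonneg_derivative[OF da2 _ order_refl t])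
      show "2 * ((a s)\<^sup>2 * Re (herglotz s 0)) \<ge> 0" if "s \<ge> 0" for s
        using ge[OF that] q_pos[OF that] by linarith
    qed
    have "B t \<le> (a t)\<^sup>2 + (K - 1) * (a 0)\<^sup>2" using 1 a0 by (simp add: K_def algebra_simps)
    also have "\<dots> \<le> (a t)\<^sup>2 + (K - 1) * (a t)\<^sup>2"
      using 2 K by (intro add_left_mono mult_left_mono) auto
    finally show ?thesis by (simp add: a_def B_def algebra_simps)
  qed
qed

lemma inj_on_fixed_ball:
  obtains \<rho> where "\<rho> > 0" "\<And>t. t \<ge> 0 \<Longrightarrow> inj_on (f t) (ball 0 \<rho>)"
proof -
  obtain K where K: "K \<ge> 1" "\<And>t. t \<ge> 0 \<Longrightarrow> circle_area (f t) \<le> K * (norm (deriv (f t) 0))\<^sup>2"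
    using circle_area_le_norm_deriv_zero_sq by blast
  show thesis
  proof (rule that)
    show "1 / (8 * K) > 0" using K by simp
    fix t :: real assume t: "t \<ge> 0"
    obtain r where "r > 1" "f t holomorphic_on ball 0 r"
      using t by (rule local_regularity)
    then show "inj_on (f t) (ball 0 (1 / (8 * K)))"
      by (intro inj_on_ball_of_circle_area[OF _ _ K(1) K(2)[OF t]] deriv_nonzero t) auto
  qed
qed

section \<open>Pairs of points with equal images\<close>

text \<open>Brouwer's theorem, applied to the Newton map, replaces the flow of the
  Loewner vector field \<open>- z * herglotz\<close> by discrete steps.\<close>

lemma preimage_step:
  assumes t: "t \<ge> 0" and z0: "norm z0 \<le> 1" and \<epsilon>: "\<epsilon> > 0"
  shows "\<forall>\<^sub>F s in at_right t. \<exists>z. f s z = f t z0 \<and>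
    norm (z - (z0 - of_real (s - t) * (z0 * herglotz t z0))) \<le> \<epsilon> * (s - t)"
proof -
  obtain r where r: "r > 1"
    and ft: "f t holomorphic_on ball 0 r" and fd: "fdot t holomorphic_on ball 0 r"
    and ev: "\<forall>\<^sub>F s in at t within {0..}. f s holomorphic_on ball 0 r"
    and lim: "uniform_limit (ball 0 r) (\<lambda>s z. (f s z - f t z) /\<^sub>R (s - t)) (fdot t) (at t within {0..})"
    using t by (rule local_regularity)
  define c where "c = deriv (f t) z0"
  define D where "D = z0 * herglotz t z0"
  have c: "c \<noteq> 0" using deriv_nonzero[OF t z0] by (simp add: c_def)
  have fdD: "fdot t z0 = c * D" using fdot_eq_herglotz[OF t z0] by (simp add: c_def D_def)
  define K where "K = norm D + \<epsilon>"
  have K: "K > 0" using \<epsilon> by (simp add: K_def add_nonneg_pos)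
  \<comment> \<open>Three errors are to be absorbed: two of size \<open>h * \<eta>\<close> and one
    of size \<open>h * \<eta> * K\<close>, where \<open>h * K\<close> bounds the distance from
    \<open>z0\<close> to points of \<open>W\<close>.\<close>
  define \<eta> where "\<eta> = \<epsilon> * norm c / (2 + K)"
  have \<eta>: "\<eta> > 0" using \<epsilon> c K by (simp add: \<eta>_def)
  have z0r: "z0 \<in> ball 0 r" using z0 r by simp
  have "(f t has_field_derivative c) (at z0)"
    unfolding c_def by (rule holomorphic_derivI[OF ft open_ball z0r])
  then have "(f t has_derivative (*) c) (at z0)" by (simp add: has_field_derivative_def)
  then obtain d1 where d1: "d1 > 0"
    "\<And>z. norm (z - z0) < d1 \<Longrightarrow> norm (f t z - f t z0 - c * (z - z0)) \<le> \<eta> * norm (z - z0)"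
    using \<eta> unfolding has_derivative_at_alt by metis
  have "isCont (fdot t) z0"
    using holomorphic_on_imp_continuous_on[OF fd] z0r by (simp add: continuous_on_eq_continuous_at)
  then obtain d2 where d2: "d2 > 0" "\<And>z. norm (z - z0) < d2 \<Longrightarrow> norm (fdot t z - fdot t z0) \<le> \<eta>"
    using \<eta> unfolding continuous_at_eps_delta by (metis dist_norm less_imp_le)
  \<comment> \<open>The bound \<open>r - 1\<close> keeps \<open>W\<close> in the domain of
    \<open>f s\<close> even when \<open>z0\<close> lies on the unit circle.\<close>
  define d where "d = min (min d1 d2) (r - 1)"
  have d: "d > 0" using d1 d2 r by (simp add: d_def)
  have le: "at_right t \<le> at t within {0..}" by (rule at_right_le_at_within_atLeast[OF t])
  have e1: "\<forall>\<^sub>F s in at_right t. f s holomorphic_on ball 0 r" by (rule filter_leD[OF le ev])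
  have e2: "\<forall>\<^sub>F s in at_right t. \<forall>z\<in>ball 0 r. dist ((f s z - f t z) /\<^sub>R (s - t)) (fdot t z) < \<eta>"
    by (rule filter_leD[OF le uniform_limitD[OF lim \<eta>]])
  have e3: "\<forall>\<^sub>F s in at_right t. s > t" by (simp add: eventually_at_right_less)
  have "((\<lambda>s. (s - t) * K) \<longlongrightarrow> (t - t) * K) (at_right t)" by (intro tendsto_intros)
  then have e4: "\<forall>\<^sub>F s in at_right t. (s - t) * K < d"
    by (rule order_tendstoD) (use d in simp)
  show ?thesis
    using e1 e2 e3 e4 unfolding D_def[symmetric]
  proof eventually_elim
    case (elim s)
    define h where "h = s - t"
    have h: "h > 0" using elim by (simp add: h_def)
    define w where "w = z0 - of_real h * D"
    define W where "W = cball w (\<epsilon> * h)"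
    \<comment> \<open>The Newton map with frozen slope \<open>c\<close>: its fixed points are the
      solutions of \<open>f s z = f t z0\<close>. The centre \<open>w\<close> of \<open>W\<close> is
      the first-order prediction, so \<open>G z - w\<close> is the error estimated below, divided by
      \<open>- c\<close>.\<close>
    define G where "G = (\<lambda>z. z - (f s z - f t z0) / c)"
    have near: "norm (z - z0) \<le> h * K" if "z \<in> W" for z
    proof -
      have "norm (z - z0) \<le> norm (z - w) + norm (w - z0)"
        using norm_triangle_ineq[of "z - w" "w - z0"] by simp
      also have "norm (z - w) \<le> \<epsilon> * h" using that by (simp add: W_def dist_norm norm_minus_commute)
      also have "norm (w - z0) = h * norm D" using h by (simp add: w_def norm_mult)
      finally show ?thesis by (simp add: K_def algebra_simps)
    qed
    have near': "norm (z - z0) < d" if "z \<in> W" for z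
      using near[OF that] elim(4) by (simp add: h_def)
    have Wr: "z \<in> ball 0 r" if "z \<in> W" for z
      using near'[OF that] z0 norm_triangle_ineq[of z0 "z - z0"] by (simp add: d_def)
    have err: "norm (f s z - f t z0 - c * (z - z0) - of_real h * fdot t z0) \<le> \<epsilon> * h * norm c"
      if z: "z \<in> W" for z
    proof -
      have "norm ((f s z - f t z) /\<^sub>R h - fdot t z) \<le> \<eta>"
        using elim(2) Wr[OF z] by (auto simp: h_def dist_norm less_imp_le)
      then have "h * norm ((f s z - f t z) /\<^sub>R h - fdot t z) \<le> h * \<eta>" using h by (intro mult_left_mono) auto
      also have "h * norm ((f s z - f t z) /\<^sub>R h - fdot t z) = norm (h *\<^sub>R ((f s z - f t z) /\<^sub>R h - fdot t z))"
        using h by simp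
      also have "h *\<^sub>R ((f s z - f t z) /\<^sub>R h - fdot t z) = f s z - f t z - of_real h * fdot t z"
        using h by (simp add: scaleR_right_diff_distrib) (simp add: scaleR_conv_of_real)
      finally have 1: "norm (f s z - f t z - of_real h * fdot t z) \<le> h * \<eta>" .
      have 2: "norm (of_real h * (fdot t z - fdot t z0)) \<le> h * \<eta>"
        using d2(2)[of z] near'[OF z] h by (simp add: norm_mult d_def)
      have "norm (f t z - f t z0 - c * (z - z0)) \<le> \<eta> * norm (z - z0)"
        using near'[OF z] by (intro d1) (simp add: d_def)
      also have "\<dots> \<le> \<eta> * (h * K)" using near[OF z] \<eta> by (intro mult_left_mono) auto
      finally have 3: "norm (f t z - f t z0 - c * (z - z0)) \<le> \<eta> * (h * K)" .
      have "f s z - f t z0 - c * (z - z0) - of_real h * fdot t z0 =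
          (f s z - f t z - of_real h * fdot t z) + of_real h * (fdot t z - fdot t z0) + (f t z - f t z0 - c * (z - z0))"
        by (simp add: algebra_simps)
      also have "norm \<dots> \<le> h * \<eta> + h * \<eta> + \<eta> * (h * K)"
        by (intro order_trans[OF norm_triangle_ineq] add_mono 1 2 3)
      also have "\<dots> = h * (\<eta> * (2 + K))" by (simp add: algebra_simps)
      also have "\<eta> * (2 + K) = \<epsilon> * norm c" using K by (simp add: \<eta>_def)
      finally show ?thesis by (simp add: mult_ac)
    qed
    have "G z \<in> W" if z: "z \<in> W" for z
    proof -
      have "G z - w = - ((f s z - f t z0 - c * (z - z0) - of_real h * fdot t z0) / c)"
        using c by (simp add: G_def w_def fdD field_simps)
      then have "norm (G z - w) = norm (f s z - f t z0 - c * (z - z0) - of_real h * fdot t z0) / norm c"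
        by (simp only: norm_minus_cancel norm_divide)
      also have "\<dots> \<le> \<epsilon> * h" using err[OF z] c by (simp add: field_simps)
      finally show ?thesis by (simp add: W_def dist_norm norm_minus_commute)
    qed
    moreover have "continuous_on W G"
    proof -
      have "continuous_on W (f s)"
        by (rule continuous_on_subset[OF holomorphic_on_imp_continuous_on[OF elim(1)]]) (use Wr in auto)
      then show ?thesis unfolding G_def using c by (intro continuous_intros) auto
    qed
    moreover have "W \<noteq> {}" using mult_pos_pos[OF \<epsilon> h] by (simp add: W_def not_less)
    ultimately obtain z where z: "z \<in> W" "G z = z"
      using brouwer[of W G] by (auto simp: W_def)
    have "f s z = f t z0" using z(2) c by (simp add: G_def)
    moreover have "norm (z - w) \<le> \<epsilon> * h" using z(1) by (simp add: W_def dist_norm norm_minus_commute)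
    ultimately show ?case unfolding w_def h_def by blast
  qed
qed

section \<open>Persistence of a pair over a short time step\<close>

text \<open>The points are existentially quantified, so that only a radius is followed in time; the
  disk is closed so that the property survives limits.\<close>

definition noninjective_on :: "real \<Rightarrow> real \<Rightarrow> bool" where
  "noninjective_on t \<rho> \<longleftrightarrow>
     (\<exists>z1 z2. z1 \<noteq> z2 \<and> norm z1 \<le> \<rho> \<and> norm z2 \<le> \<rho> \<and> f t z1 = f t z2)"

lemma noninjective_on_mono: "noninjective_on t \<rho> \<Longrightarrow> \<rho> \<le> \<rho>' \<Longrightarrow> noninjective_on t \<rho>'"
  unfolding noninjective_on_def by (meson order_trans)

text \<open>To first order \<open>z0\<close> is multiplied by \<open>1 - (s - t) * p\<close>, where
  \<open>p = herglotz t z0\<close>, and this contracts at rate \<open>Re p\<close>. The closeness to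
  \<open>z0\<close> is recorded so that two continued points can be kept apart.\<close>

lemma preimage_step_norm:
  assumes t: "t \<ge> 0" and z0: "norm z0 \<le> \<rho>" and \<rho>: "0 < \<rho>" "\<rho> \<le> 1"
    and \<kappa>: "\<kappa> > 0" "\<kappa> < Re (herglotz t z0)" and \<delta>: "\<delta> > 0"
  shows "\<forall>\<^sub>F s in at_right t. \<exists>z. f s z = f t z0 \<and> norm z \<le> \<rho> * (1 - \<kappa> * (s - t)) \<and> norm (z - z0) < \<delta>"
proof -
  define p where "p = herglotz t z0"
  \<comment> \<open>The midpoint splits the slack: \<open>Re p - \<kappa>'\<close> absorbs the
    quadratic term of the squared modulus, \<open>\<kappa>' - \<kappa>\<close> the displacement
    \<open>\<epsilon> * h\<close>.\<close>
  define \<kappa>' where "\<kappa>' = (\<kappa> + Re p) / 2"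
  have \<kappa>': "\<kappa> < \<kappa>'" "\<kappa>' < Re p" using \<kappa> by (auto simp: \<kappa>'_def p_def)
  define \<epsilon> where "\<epsilon> = \<rho> * (\<kappa>' - \<kappa>)"
  have \<epsilon>: "\<epsilon> > 0" using \<rho> \<kappa>' by (simp add: \<epsilon>_def)
  have lim: "((\<lambda>s. (s - t) * C) \<longlongrightarrow> (t - t) * C) (at_right t)" for C :: real by (intro tendsto_intros)
  have small: "\<forall>\<^sub>F s in at_right t. (s - t) * C < e" if "e > 0" for C e :: real
    by (rule order_tendstoD(2)[OF lim]) (use that in simp)
  have e0: "\<forall>\<^sub>F s in at_right t. s > t" by (simp add: eventually_at_right_less)
  have e1: "\<forall>\<^sub>F s in at_right t. (s - t) * (norm p)\<^sup>2 < 2 * (Re p - \<kappa>')" by (rule small) (use \<kappa>' in simp)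
  have e2: "\<forall>\<^sub>F s in at_right t. (s - t) * \<kappa>' < 1" by (rule small) simp
  have e3: "\<forall>\<^sub>F s in at_right t. (s - t) * (norm (z0 * p) + \<epsilon>) < \<delta>" by (rule small[OF \<delta>])
  have "\<forall>\<^sub>F s in at_right t. \<exists>z. f s z = f t z0 \<and>
      norm (z - (z0 - of_real (s - t) * (z0 * p))) \<le> \<epsilon> * (s - t)"
    unfolding p_def by (rule preimage_step[OF t _ \<epsilon>]) (use z0 \<rho> in linarith)
  with e0 e1 e2 e3 show ?thesis
  proof eventually_elim
    case (elim s)
    define h where "h = s - t"
    have h: "h > 0" using elim by (simp add: h_def)
    obtain z where z: "f s z = f t z0" "norm (z - (z0 - of_real h * (z0 * p))) \<le> \<epsilon> * h"
      using elim(5) by (auto simp: h_def)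
    have "(norm (1 - of_real h * p))\<^sup>2 = 1 - 2 * h * Re p + h * (h * (norm p)\<^sup>2)"
      unfolding cmod_power2 by (simp add: power2_eq_square algebra_simps)
    also have "\<dots> \<le> 1 - 2 * h * Re p + h * (2 * (Re p - \<kappa>'))"
      using elim(2) h by (intro add_left_mono mult_left_mono) (auto simp: h_def)
    also have "\<dots> = 1 - 2 * h * \<kappa>'" by (simp add: algebra_simps)
    also have "\<dots> \<le> (1 - h * \<kappa>')\<^sup>2" using zero_le_power2[of "h * \<kappa>'"] by (simp add: power2_eq_square algebra_simps)
    finally have fac: "norm (1 - of_real h * p) \<le> 1 - h * \<kappa>'"
      by (rule power2_le_imp_le) (use elim(3) in \<open>simp add: h_def\<close>)
    have "norm (z0 - of_real h * (z0 * p)) = norm z0 * norm (1 - of_real h * p)"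
      by (simp add: norm_mult[symmetric] algebra_simps)
    also have "\<dots> \<le> \<rho> * (1 - h * \<kappa>')" using z0 \<rho> fac by (intro mult_mono) auto
    finally have "norm z \<le> \<rho> * (1 - h * \<kappa>') + \<epsilon> * h"
      using z(2) norm_triangle_ineq[of "z0 - of_real h * (z0 * p)" "z - (z0 - of_real h * (z0 * p))"] by simp
    also have "\<dots> = \<rho> * (1 - \<kappa> * (s - t))" by (simp add: \<epsilon>_def h_def algebra_simps)
    finally have n: "norm z \<le> \<rho> * (1 - \<kappa> * (s - t))" .
    have "norm (z - z0) \<le> norm (z - (z0 - of_real h * (z0 * p))) + norm (of_real h * (z0 * p))"
      using norm_triangle_ineq4[of "z - (z0 - of_real h * (z0 * p))" "of_real h * (z0 * p)"] by simp
    also have "\<dots> \<le> \<epsilon> * h + h * norm (z0 * p)" using z(2) h by (simp add: norm_mult)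
    also have "\<dots> < \<delta>" using elim(4) by (simp add: h_def algebra_simps)
    finally show ?case using z(1) n by blast
  qed
qed

text \<open>Each point is continued separately while keeping its image. Moving each by less than
  half their distance leaves them distinct.\<close>

lemma noninjective_on_step:
  assumes t: "t \<ge> 0" and non: "noninjective_on t \<rho>" and \<rho>: "0 < \<rho>" "\<rho> \<le> 1"
    and \<kappa>: "\<kappa> > 0" "\<And>z. norm z \<le> \<rho> \<Longrightarrow> \<kappa> < Re (herglotz t z)"
  shows "\<forall>\<^sub>F s in at_right t. noninjective_on s (\<rho> * (1 - \<kappa> * (s - t)))"
proof -
  obtain z1 z2 where z: "z1 \<noteq> z2" "norm z1 \<le> \<rho>" "norm z2 \<le> \<rho>" "f t z1 = f t z2"
    using non by (auto simp: noninjective_on_def)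
  define \<delta> where "\<delta> = dist z1 z2 / 2"
  have \<delta>: "\<delta> > 0" using z by (simp add: \<delta>_def)
  note step = preimage_step_norm[OF t _ \<rho> \<kappa>(1) \<kappa>(2) \<delta>]
  show ?thesis
    using step[OF z(2) z(2)] step[OF z(3) z(3)]
  proof eventually_elim
    case (elim s)
    then obtain w1 w2 where w: "f s w1 = f t z1" "norm w1 \<le> \<rho> * (1 - \<kappa> * (s - t))" "norm (w1 - z1) < \<delta>"
      "f s w2 = f t z2" "norm w2 \<le> \<rho> * (1 - \<kappa> * (s - t))" "norm (w2 - z2) < \<delta>" by blast
    have "w1 \<noteq> w2"
    proof
      assume "w1 = w2"
      then have "dist z1 z2 < \<delta> + \<delta>"
        using dist_triangle_less_add[of z1 w1 \<delta> z2 \<delta>] w by (simp add: dist_norm norm_minus_commute)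
      then show False by (simp add: \<delta>_def)
    qed
    then show ?case using w z(4) unfolding noninjective_on_def by metis
  qed
qed

section \<open>Persistence of pairs in limits\<close>

lemma uniformly_near_in_time:
  assumes t: "t \<ge> 0" and e: "e > 0"
  obtains \<delta> where "\<delta> > 0" "\<And>s z. s \<ge> 0 \<Longrightarrow> \<bar>s - t\<bar> < \<delta> \<Longrightarrow> norm z \<le> 1 \<Longrightarrow> norm (f s z - f t z) < e"
    "\<And>s z. s \<ge> 0 \<Longrightarrow> \<bar>s - t\<bar> < \<delta> \<Longrightarrow> norm z \<le> 1 \<Longrightarrow> norm (deriv (f s) z - deriv (f t) z) < e"
proof -
  obtain r where r: "r > 1"
    and limf: "uniform_limit (ball 0 r) f (f t) (at t within {0..})"
    and limf': "uniform_limit (ball 0 r) (\<lambda>s. deriv (f s)) (deriv (f t)) (at t within {0..})"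
    using t by (rule local_regularity)
  have "\<forall>\<^sub>F s in at t within {0..}. (\<forall>z\<in>ball 0 r. dist (f s z) (f t z) < e) \<and>
      (\<forall>z\<in>ball 0 r. dist (deriv (f s) z) (deriv (f t) z) < e)"
    by (intro eventually_conj uniform_limitD[OF limf e] uniform_limitD[OF limf' e])
  then obtain \<delta> where \<delta>: "\<delta> > 0" "\<And>s. s \<ge> 0 \<Longrightarrow> s \<noteq> t \<Longrightarrow> \<bar>s - t\<bar> < \<delta> \<Longrightarrow>
      (\<forall>z\<in>ball 0 r. dist (f s z) (f t z) < e) \<and> (\<forall>z\<in>ball 0 r. dist (deriv (f s) z) (deriv (f t) z) < e)"
    unfolding eventually_at by (auto simp: dist_real_def)
  show thesis
  proof (rule that[OF \<delta>(1)])
    show "norm (f s z - f t z) < e" if "s \<ge> 0" "\<bar>s - t\<bar> < \<delta>" "norm z \<le> 1" for s z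
      using \<delta>(2)[OF that(1) _ that(2)] that(3) r e by (cases "s = t") (auto simp: dist_norm)
    show "norm (deriv (f s) z - deriv (f t) z) < e" if "s \<ge> 0" "\<bar>s - t\<bar> < \<delta>" "norm z \<le> 1" for s z
      using \<delta>(2)[OF that(1) _ that(2)] that(3) r e by (cases "s = t") (auto simp: dist_norm)
  qed
qed

text \<open>Near \<open>w\<close> and near time \<open>t\<close> the space derivative stays within
  half of \<open>norm c\<close> of its nonzero value \<open>c\<close> at \<open>w\<close>: one
  quarter is spent on space and one on time.\<close>

lemma locally_injective_near:
  assumes t: "t \<ge> 0" and w: "norm w \<le> 1"
  obtains \<delta> where "\<delta> > 0" "\<And>s. s \<ge> 0 \<Longrightarrow> \<bar>s - t\<bar> < \<delta> \<Longrightarrow> inj_on (f s) (ball w \<delta> \<inter> cball 0 1)"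
proof -
  define c where "c = deriv (f t) w"
  have c: "norm c > 0" using deriv_nonzero[OF t w] by (simp add: c_def)
  have "continuous_on (cball 0 1) (deriv (f t))"
    by (intro holomorphic_on_imp_continuous_on deriv_holomorphic_on_cball t)
  then obtain d where d: "d > 0" "\<And>z. z \<in> cball 0 1 \<Longrightarrow> dist z w < d \<Longrightarrow> dist (deriv (f t) z) c < norm c / 4"
    unfolding continuous_on_iff c_def using w c by (metis c_def divide_pos_pos mem_cball_0 zero_less_numeral)
  obtain \<delta> where \<delta>: "\<delta> > 0" "\<And>s z. s \<ge> 0 \<Longrightarrow> \<bar>s - t\<bar> < \<delta> \<Longrightarrow> norm z \<le> 1 \<Longrightarrow> norm (deriv (f s) z - deriv (f t) z) < norm c / 4"
    using uniformly_near_in_time[OF t, of "norm c / 4"] c by (metis divide_pos_pos zero_less_numeral)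
  show thesis
  proof (rule that[of "min d \<delta>"])
    show "min d \<delta> > 0" using d \<delta> by simp
    fix s :: real assume s: "s \<ge> 0" "\<bar>s - t\<bar> < min d \<delta>"
    show "inj_on (f s) (ball w (min d \<delta>) \<inter> cball 0 1)"
    proof (rule inj_on_deriv_near_const[where c = c and k = "norm c / 2" and g' = "deriv (f s)"])
      show "convex (ball w (min d \<delta>) \<inter> cball 0 1)" by (intro convex_Int) auto
      fix z assume z: "z \<in> ball w (min d \<delta>) \<inter> cball 0 1"
      show "(f s has_field_derivative deriv (f s) z) (at z)"
        using analytic_on_imp_differentiable_at[OF f_analytic[OF s(1)]] z
        by (intro DERIV_deriv_iff_field_differentiable[THEN iffD2]) auto
      have "norm (deriv (f s) z - deriv (f t) z) < norm c / 4" using \<delta>(2)[of s z] s z by simp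
      moreover have "norm (deriv (f t) z - c) < norm c / 4"
        using d(2)[of z] z by (simp add: dist_norm norm_minus_commute)
      ultimately show "norm (deriv (f s) z - c) \<le> norm c / 2"
        using norm_triangle_ineq[of "deriv (f s) z - deriv (f t) z" "deriv (f t) z - c"] by simp
    qed (use c in auto)
  qed
qed

text \<open>Compactness provides a limit pair with equal images. The danger is that its points
  coincide; then both points of a late pair would lie in a disk on which \<open>f\<close> at that
  time is injective.\<close>

lemma noninjective_on_limit:
  assumes s: "\<And>n. s n \<ge> 0" "s \<longlonglongrightarrow> t" and \<rho>: "\<And>n. \<rho> n \<le> 1" "\<rho> \<longlonglongrightarrow> \<rho>0"
    and non: "\<And>n. noninjective_on (s n) (\<rho> n)"
  shows "noninjective_on t \<rho>0"
proof -
  have t: "t \<ge> 0" by (rule LIMSEQ_le_const[OF s(2)]) (use s in auto)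
  obtain u v where uv: "\<And>n. u n \<noteq> v n" "\<And>n. norm (u n) \<le> \<rho> n" "\<And>n. norm (v n) \<le> \<rho> n"
    "\<And>n. f (s n) (u n) = f (s n) (v n)"
    using non unfolding noninjective_on_def by metis
  have uv1: "norm (u n) \<le> 1" "norm (v n) \<le> 1" for n using uv(2,3)[of n] \<rho>(1)[of n] by linarith+
  have comp: "compact (cball (0::complex) 1 \<times> cball (0::complex) 1)" by (intro compact_Times) auto
  have "\<exists>l\<in>cball 0 1 \<times> cball 0 1. \<exists>k. strict_mono k \<and> ((\<lambda>n. (u n, v n)) \<circ> k) \<longlonglongrightarrow> l"
    by (rule comp[unfolded compact_def, rule_format]) (use uv1 in auto)
  then obtain l k where lk: "l \<in> cball 0 1 \<times> cball 0 1" "strict_mono k"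
    and lim: "((\<lambda>n. (u n, v n)) \<circ> k) \<longlonglongrightarrow> l"
    by blast
  define z1 z2 where "z1 = fst l" and "z2 = snd l"
  have z1: "(\<lambda>n. u (k n)) \<longlonglongrightarrow> z1" using tendsto_fst[OF lim] by (simp add: o_def z1_def)
  have z2: "(\<lambda>n. v (k n)) \<longlonglongrightarrow> z2" using tendsto_snd[OF lim] by (simp add: o_def z2_def)
  have sk: "(\<lambda>n. s (k n)) \<longlonglongrightarrow> t" using LIMSEQ_subseq_LIMSEQ[OF s(2) lk(2)] by (simp add: o_def)
  have \<rho>k: "(\<lambda>n. \<rho> (k n)) \<longlonglongrightarrow> \<rho>0" using LIMSEQ_subseq_LIMSEQ[OF \<rho>(2) lk(2)] by (simp add: o_def)
  have n1: "norm z1 \<le> \<rho>0"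
    by (rule LIMSEQ_le[OF tendsto_norm[OF z1] \<rho>k]) (use uv in auto)
  have n2: "norm z2 \<le> \<rho>0"
    by (rule LIMSEQ_le[OF tendsto_norm[OF z2] \<rho>k]) (use uv in auto)
  have \<rho>01: "\<rho>0 \<le> 1" by (rule LIMSEQ_le_const2[OF \<rho>(2)]) (use \<rho> in auto)
  have conv: "(\<lambda>n. f (s (k n)) (w n)) \<longlonglongrightarrow> f t z"
    if w: "\<And>n. norm (w n) \<le> 1" "w \<longlonglongrightarrow> z" and z: "norm z \<le> 1" for w :: "nat \<Rightarrow> complex" and z
  proof -
    have "(\<lambda>n. f (s (k n)) (w n) - f t (w n)) \<longlonglongrightarrow> 0"
    proof (rule tendstoI)
      fix e :: real assume e: "e > 0"
      obtain \<delta> where \<delta>: "\<delta> > 0" "\<And>s z. s \<ge> 0 \<Longrightarrow> \<bar>s - t\<bar> < \<delta> \<Longrightarrow> norm z \<le> 1 \<Longrightarrow> norm (f s z - f t z) < e"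
        using uniformly_near_in_time[OF t e] by metis
      have "\<forall>\<^sub>F n in sequentially. dist (s (k n)) t < \<delta>" by (rule tendstoD[OF sk \<delta>(1)])
      then show "\<forall>\<^sub>F n in sequentially. dist (f (s (k n)) (w n) - f t (w n)) 0 < e"
        by eventually_elim (use \<delta>(2) s w in \<open>auto simp: dist_real_def\<close>)
    qed
    moreover have "(\<lambda>n. f t (w n)) \<longlonglongrightarrow> f t z"
      by (rule continuous_on_tendsto_compose[OF holomorphic_on_imp_continuous_on[OF analytic_imp_holomorphic[OF f_analytic[OF t]]] w(2)])
        (use w z in auto)
    ultimately show ?thesis using tendsto_add by fastforce
  qed
  have "f t z1 = f t z2"
  proof (rule LIMSEQ_unique[OF conv[OF uv1(1) z1]])
    show "(\<lambda>n. f (s (k n)) (u (k n))) \<longlonglongrightarrow> f t z2"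
      unfolding uv(4) by (rule conv[OF uv1(2) z2]) (use n2 \<rho>01 in linarith)
  qed (use n1 \<rho>01 in linarith)
  moreover have "z1 \<noteq> z2"
  proof
    assume eq: "z1 = z2"
    have z1n: "norm z1 \<le> 1" using n1 \<rho>01 by linarith
    obtain \<delta> where \<delta>: "\<delta> > 0" "\<And>s. s \<ge> 0 \<Longrightarrow> \<bar>s - t\<bar> < \<delta> \<Longrightarrow> inj_on (f s) (ball z1 \<delta> \<inter> cball 0 1)"
      using locally_injective_near[OF t z1n] by metis
    have "\<forall>\<^sub>F n in sequentially. dist (s (k n)) t < \<delta> \<and> dist (u (k n)) z1 < \<delta> \<and> dist (v (k n)) z1 < \<delta>"
      using z2 unfolding eq[symmetric] by (intro eventually_conj tendstoD \<delta>(1) sk z1)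
    then obtain n where n: "dist (s (k n)) t < \<delta>" "dist (u (k n)) z1 < \<delta>" "dist (v (k n)) z1 < \<delta>"
      by (auto dest: eventually_happens)
    have "u (k n) = v (k n)"
      by (rule inj_onD[OF \<delta>(2)[OF s(1)] uv(4)])
        (use n uv1 in \<open>auto simp: dist_real_def dist_commute\<close>)
    then show False using uv(1) by blast
  qed
  ultimately show ?thesis using n1 n2 unfolding noninjective_on_def by blast
qed

text \<open>A pair of points with equal images is pushed towards \<open>0\<close> at a speed controlled from below by
  Harnack's inequality. The radius \<open>g\<close> below shrinks more slowly than such a pair, but still tends to \<open>0\<close>
  because the area tends to infinity.\<close>

lemma noninjective_on_shrinks:
  assumes T: "T \<ge> 0" and non: "noninjective_on T r0" and r0: "0 < r0" "r0 < 1" and \<epsilon>: "\<epsilon> > 0"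
  obtains b where "b \<ge> 0" "noninjective_on b \<epsilon>"
proof -
  define B where "B = (\<lambda>t. circle_area (f t))"
  define c0 where "c0 = (1 - r0) / (1 + r0)"
  have c0: "c0 > 0" using r0 by (simp add: c0_def)
  \<comment> \<open>That is, \<open>r0\<close> times the power \<open>c0 / 4\<close> of
    \<open>B T / B t\<close>. As \<open>B' = 2 * q\<close>, it decays at the relative rate
    \<open>c0 * q / (2 * B)\<close>, half of what Harnack guarantees for pairs.\<close>
  define g where "g = (\<lambda>t. r0 * exp (c0 / 4 * (ln (B T) - ln (B t))))"
  have Bpos: "B t > 0" if "t \<ge> 0" for t using circle_area_pos[OF that] by (simp add: B_def)
  have dB: "(B has_real_derivative 2 * q t) (at t within {0..})" if "t \<ge> 0" for t
    using has_real_derivative_circle_area[OF that] by (simp add: B_def)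
  have dg: "(g has_real_derivative - (c0 * q t / (2 * B t)) * g t) (at t within {0..})" if "t \<ge> 0" for t
    unfolding g_def
    by (rule derivative_eq_intros dB[OF that] Bpos[OF that] refl)+ (use Bpos[OF that] in \<open>simp add: field_simps\<close>)
  have gpos: "g t > 0" for t using r0 by (simp add: g_def)
  have gT: "g T = r0" by (simp add: g_def)
  have gle: "g t \<le> r0" if "t \<ge> T" for t
  proof -
    have "B T \<le> B t"
      by (rule le_of_nonneg_derivative[OF dB _ T that]) (use q_pos in \<open>auto intro: less_imp_le\<close>)
    then show ?thesis using Bpos[OF T] Bpos[of t] T that c0 r0 by (simp add: g_def mult_le_0_iff)
  qed
  have gstep: "\<forall>\<^sub>F s in at_right t. noninjective_on s (g s)" if t: "t \<ge> T" and nt: "noninjective_on t (g t)" for t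
  proof -
    have t0: "t \<ge> 0" using t T by simp
    \<comment> \<open>The factor 3/4 lies strictly between the guaranteed rate (factor 1) and that
      of \<open>g\<close> (factor 1/2); both strict gaps are used.\<close>
    define \<kappa> where "\<kappa> = 3 / 4 * (c0 * q t / B t)"
    have qB: "c0 * q t / B t > 0" using c0 q_pos[OF t0] Bpos[OF t0] by simp
    have \<kappa>: "\<kappa> > 0" unfolding \<kappa>_def by (rule mult_pos_pos[OF _ qB]) simp
    have "\<forall>\<^sub>F s in at_right t. noninjective_on s (g t * (1 - \<kappa> * (s - t)))"
    proof (rule noninjective_on_step[OF t0 nt gpos _ \<kappa>])
      show "g t \<le> 1" using gle[OF t] r0 by simp
      fix z :: complex assume "norm z \<le> g t"
      then have z: "norm z \<le> r0" "norm z < 1" using gle[OF t] r0 by auto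
      have H0: "Re (herglotz t 0) \<ge> q t / B t"
      proof -
        have "q t / B t \<le> q t / (norm (deriv (f t) 0))\<^sup>2"
          using norm_deriv_zero_sq_le_circle_area[OF t0] deriv_nonzero[OF t0, of 0] q_pos[OF t0] Bpos[OF t0]
          by (intro divide_left_mono) (auto simp: B_def)
        then show ?thesis using Re_herglotz_zero_ge[OF t0] by linarith
      qed
      have "c0 * (q t / B t) \<le> (1 - norm z) / (1 + norm z) * Re (herglotz t 0)"
        using H0 q_pos[OF t0] Bpos[OF t0] z r0 unfolding c0_def by (intro mult_mono frac_le) (auto intro: add_pos_nonneg)
      also have "\<dots> = Re (herglotz t 0) * (1 - norm z) / (1 + norm z)" by simp
      also have "\<dots> \<le> Re (herglotz t z)"
        by (rule harnack_Re_lower[OF holomorphic_on_subset[OF herglotz_holomorphic[OF t0]] Re_herglotz_pos[OF t0] z(2)]) auto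
      finally have "c0 * q t / B t \<le> Re (herglotz t z)" by simp
      moreover have "\<kappa> < c0 * q t / B t"
        unfolding \<kappa>_def using mult_strict_right_mono[OF _ qB, of "3 / 4" 1] by simp
      ultimately show "\<kappa> < Re (herglotz t z)" by linarith
    qed
    moreover have "\<forall>\<^sub>F s in at_right t. g t * (1 - \<kappa> * (s - t)) \<le> g s"
    proof -
      have "((\<lambda>s. (g s - g t) / (s - t)) \<longlongrightarrow> - (c0 * q t / (2 * B t)) * g t) (at_right t)"
        using dg[OF t0] tendsto_mono[OF at_right_le_at_within_atLeast[OF t0]]
        unfolding has_field_derivative_iff by blast
      moreover have "- \<kappa> * g t < - (c0 * q t / (2 * B t)) * g t"
        using qB gpos[of t] by (intro mult_strict_right_mono) (auto simp: \<kappa>_def)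
      ultimately have "\<forall>\<^sub>F s in at_right t. - \<kappa> * g t < (g s - g t) / (s - t)"
        by (rule order_tendstoD)
      moreover have "\<forall>\<^sub>F s in at_right t. s > t" by (simp add: eventually_at_right_less)
      ultimately show ?thesis
        by eventually_elim (simp add: field_simps)
    qed
    ultimately show ?thesis
      by eventually_elim (rule noninjective_on_mono)
  qed
  \<comment> \<open>This threshold for \<open>ln (B t)\<close> is precisely what brings
    \<open>g\<close> down to \<open>\<epsilon>\<close>.\<close>
  have "\<forall>\<^sub>F t in at_top. ln (B t) > ln (B T) + 4 / c0 * ln (r0 / \<epsilon>)"
    using filterlim_compose[OF ln_at_top circle_area_at_top] unfolding B_def filterlim_at_top_dense by blast
  with eventually_ge_at_top[of T] obtain b where b: "b \<ge> T" "ln (B b) > ln (B T) + 4 / c0 * ln (r0 / \<epsilon>)"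
    by (metis (mono_tags, lifting) eventually_conj eventually_happens trivial_limit_at_top_linorder)
  have gb: "g b \<le> \<epsilon>"
  proof -
    have "c0 / 4 * (ln (B T) - ln (B b)) \<le> c0 / 4 * (- (4 / c0 * ln (r0 / \<epsilon>)))"
      using b c0 by (intro mult_left_mono) auto
    also have "\<dots> = - ln (r0 / \<epsilon>)" using c0 by simp
    finally have "exp (c0 / 4 * (ln (B T) - ln (B b))) \<le> exp (- ln (r0 / \<epsilon>))" by simp
    also have "\<dots> = \<epsilon> / r0" using r0 \<epsilon> by (simp add: exp_minus)
    finally show ?thesis using r0 by (simp add: g_def field_simps)
  qed
  \<comment> \<open>Real induction: \<open>S\<close> is closed by the limit lemma and extends to the
    right of each of its points before \<open>b\<close>, so its supremum is
    \<open>b\<close>.\<close>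
  define S where "S = {t \<in> {T..b}. noninjective_on t (g t)}"
  have "continuous_on {0..} g" by (rule DERIV_continuous_on[OF dg]) auto
  have "closed S"
    unfolding closed_sequential_limits
  proof (intro allI impI)
    fix s l assume sl: "(\<forall>n. s n \<in> S) \<and> s \<longlonglongrightarrow> l"
    then have sn: "\<And>n. T \<le> s n" "\<And>n. s n \<le> b" "\<And>n. noninjective_on (s n) (g (s n))" by (auto simp: S_def)
    have l: "T \<le> l" "l \<le> b" using sl sn by (auto intro: LIMSEQ_le_const LIMSEQ_le_const2)
    have "(\<lambda>n. g (s n)) \<longlonglongrightarrow> g l"
      by (rule continuous_on_tendsto_compose[OF \<open>continuous_on {0..} g\<close>])
        (use sl order_trans[OF T l(1)] order_trans[OF T sn(1)] in auto)
    then have "noninjective_on l (g l)"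
    proof (rule noninjective_on_limit[rotated 3])
      show "s n \<ge> 0" for n using sn(1)[of n] T by linarith
      show "g (s n) \<le> 1" for n using gle[OF sn(1)[of n]] r0 by linarith
    qed (use sl sn in auto)
    then show "l \<in> S" using l by (simp add: S_def)
  qed
  have TS: "T \<in> S" using b non by (simp add: S_def gT)
  have bdd: "bdd_above S" by (rule bdd_aboveI[of _ b]) (simp add: S_def)
  define \<tau> where "\<tau> = Sup S"
  have \<tau>: "\<tau> \<in> S" unfolding \<tau>_def by (rule closed_contains_Sup) (use TS bdd \<open>closed S\<close> in auto)
  have "\<tau> = b"
  proof (rule ccontr)
    assume "\<tau> \<noteq> b"
    then have lt: "\<tau> < b" using \<tau> by (simp add: S_def)
    have "\<forall>\<^sub>F s in at_right \<tau>. noninjective_on s (g s)" using \<tau> by (intro gstep) (auto simp: S_def)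
    moreover have "\<forall>\<^sub>F s in at_right \<tau>. s \<in> {\<tau><..<b}" by (rule eventually_at_right_real[OF lt])
    ultimately have "\<forall>\<^sub>F s in at_right \<tau>. s \<in> S \<and> s > \<tau>"
      by eventually_elim (use \<tau> in \<open>auto simp: S_def\<close>)
    then obtain s where "s \<in> S" "s > \<tau>" using eventually_happens by fastforce
    then show False using cSup_upper[OF _ bdd, of s] by (simp add: \<tau>_def)
  qed
  then have "noninjective_on b (g b)" using \<tau> by (simp add: S_def)
  then have "noninjective_on b \<epsilon>" using gb by (rule noninjective_on_mono)
  then show thesis using b T by (intro that[of b]) auto
qed

lemma univalent:
  assumes T: "T \<ge> 0" shows "inj_on (f T) (cball 0 1)"
proof (rule ccontr)
  assume "\<not> inj_on (f T) (cball 0 1)"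
  then obtain x y where "norm x \<le> 1" "norm y \<le> 1" "f T x = f T y" "x \<noteq> y"
    unfolding inj_on_def by auto
  then have non: "noninjective_on T 1"
    unfolding noninjective_on_def by (intro exI[of _ x] exI[of _ y]) simp
  obtain m where m: "m > 0" "\<And>z. norm z \<le> 1 \<Longrightarrow> Re (herglotz T z) \<ge> m"
    using Re_herglotz_bounded_below[OF T] by metis
  \<comment> \<open>At radius 1 Harnack gives nothing, so the bound up to the circle is used;
    halving \<open>m\<close> makes the inequality strict.\<close>
  have "\<forall>\<^sub>F s in at_right T. noninjective_on s (1 * (1 - m / 2 * (s - T)))"
    by (rule noninjective_on_step[OF T non]) (use m in \<open>force+\<close>)
  moreover have "\<forall>\<^sub>F s in at_right T. s > T" by (simp add: eventually_at_right_less)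
  ultimately have "\<forall>\<^sub>F s in at_right T. s > T \<and> noninjective_on s (1 - m / 2 * (s - T))"
    by eventually_elim simp
  then obtain s where s: "s > T" and nons: "noninjective_on s (1 - m / 2 * (s - T))"
    using eventually_happens by fastforce
  define r0 where "r0 = 1 - m / 2 * (s - T)"
  \<comment> \<open>A closed disk of radius at most 0 cannot contain two distinct points.\<close>
  have "0 < r0"
  proof -
    obtain z1 z2 :: complex where "z1 \<noteq> z2" "norm z1 \<le> r0" "norm z2 \<le> r0"
      using nons by (auto simp: noninjective_on_def r0_def)
    then show ?thesis by (smt (verit) norm_le_zero_iff)
  qed
  moreover have "r0 < 1" using m s by (simp add: r0_def)
  moreover obtain \<rho> where \<rho>: "\<rho> > 0" "\<And>t. t \<ge> 0 \<Longrightarrow> inj_on (f t) (ball 0 \<rho>)"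
    using inj_on_fixed_ball by blast
  \<comment> \<open>Half of \<open>\<rho>\<close> puts the closed disk of the pair inside the open
    ball of injectivity.\<close>
  ultimately obtain b where b: "b \<ge> 0" "noninjective_on b (\<rho> / 2)"
    using noninjective_on_shrinks[of s r0 "\<rho> / 2"] nons s T r0_def by auto
  then obtain z1 z2 where z: "z1 \<noteq> z2" "norm z1 \<le> \<rho> / 2" "norm z2 \<le> \<rho> / 2" "f b z1 = f b z2"
    by (auto simp: noninjective_on_def)
  have "z1 = z2" by (rule inj_onD[OF \<rho>(2)[OF b(1)] z(4)]) (use z \<rho> in auto)
  then show False using z by blast
qed

end

theorem theorem4p1:
  fixes f :: "real \<Rightarrow> complex \<Rightarrow> complex" and q :: "real \<Rightarrow> real"
  assumes "continuous_on {0..} q"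
    and "\<And>t. t \<ge> 0 \<Longrightarrow> q t > 0"
    and "filterlim (\<lambda>t. integral {0..t} q) at_top at_top"
    and "locally_univalent_PG_solution {0..} q f"
  shows "\<forall>t\<ge>0. inj_on (f t) (cball 0 1)"
proof -
  interpret global_PG_solution f q
    by unfold_locales (use assms in auto)
  show ?thesis using univalent by blast
qed

end
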